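(* Let $\Gamma$ be a simple graph of order $n>0$ with $c$ connected components, let $\mathfrak{G}$ be a finite group of order $\gamma>0$, and let $i\in\{0,1,\dots,n\}$. Then the signless Whitney number $\bar w_i(\mathfrak{G}\cdot\Gamma^{(V)})$ is a polynomial function of $\gamma$ of degree $\min(i,n-c)$, with positive coefficients; namely, $$\bar w_i(\mathfrak{G}\cdot\Gamma^{(V)}) = \sum_{0\le j\le i} \bar w_j(\Gamma)\binom{n-j}{i-j}\gamma^j .$$
   Context: A gain graph $\Phi$ over a group $\mathfrak{G}$ consists of a graph (possibly with half edges, i.e. edges with only one endpoint) on vertex set $V$, $|V|=n$, together with a map $\phi$ assigning to each oriented (ordinary) edge an element of $\mathfrak{G}$ such that reversing the orientation inverts the gain. The gain of a circle $C=e_1e_2\cdots e_l$ (traversed in a direction) is $\phi(e_1)\cdots\phi(e_l)$; $C$ is neutral if this is the identity (this property does not depend on starting point or direction). An edge set is balanced if it contains no half edges and every circle in it is neutral. For $S\subseteq E(\Phi)$, $b(S)$ denotes the number of connected components of the spanning subgraph $(V,S)$ whose edge sets are balanced. The chromatic polynomial is $\chi_\Phi(\lambda)=\sum_{S\subseteq E(\Phi)}(-1)^{|S|}\lambda^{b(S)}$, the signless chromatic polynomial is $\bar\chi_\Phi(\lambda)=(-1)^n\chi_\Phi(-\lambda)$, and the signless Whitney numbers $\bar w_i(\Phi)$ are defined by $\bar\chi_\Phi(\lambda)=\sum_{i=0}^{n}\bar w_i(\Phi)\lambda^{n-i}$. For an ordinary graph $\Gamma$ of order $n$, $\bar w_j(\Gamma)$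 is defined in the same way from its usual chromatic polynomial $\chi_\Gamma$ (equivalently, from $\Gamma$ with all gains trivial), i.e. $(-1)^n\chi_\Gamma(-\lambda)=\sum_j \bar w_j(\Gamma)\lambda^{n-j}$. The $\mathfrak{G}$-expansion $\mathfrak{G}\cdot\Gamma$ of a graph $\Gamma=(V,E)$ is the gain graph on vertex set $V$ having, for each edge $e\in E$ (with a fixed orientation) and each $g\in\mathfrak{G}$, an edge $ge$ with the same endpoints and gain $g$ in that orientation. For $X\subseteq V$, $\mathfrak{G}\cdot\Gamma^{(X)}$ is $\mathfrak{G}\cdot\Gamma$ with one half edge added at each vertex of $X$; $\mathfrak{G}\cdot\Gamma^{(V)}$ is the full $\mathfrak{G}$-expansion. *)

theory Defs
  imports
    "HOL-Library.FuncSet"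
    "HOL-Computational_Algebra.Polynomial"
    "HOL-Algebra.Coset"
begin

definition simple_graph :: "'v set \<Rightarrow> 'v set set \<Rightarrow> bool" where
  "simple_graph V E \<longleftrightarrow> finite V \<and> (\<forall>e\<in>E. e \<subseteq> V \<and> card e = 2)"

definition conn_classes :: "'v set \<Rightarrow> ('v \<times> 'v) set \<Rightarrow> 'v set set" where
  "conn_classes V R = V // {(u, v). u \<in> V \<and> v \<in> V \<and> (u, v) \<in> (R \<union> R\<inverse>)\<^sup>*}"

definition graph_components :: "'v set \<Rightarrow> 'v set set \<Rightarrow> 'v set set" where
  "graph_components V E = conn_classes V {(u, v). {u, v} \<in> E}"

definition proper_colorings :: "'v set \<Rightarrow> 'v set set \<Rightarrow> nat \<Rightarrow> ('v \<Rightarrow> nat) set" where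
  "proper_colorings V E k =
     {f \<in> V \<rightarrow>\<^sub>E {..<k}. \<forall>u\<in>V. \<forall>v\<in>V. {u, v} \<in> E \<longrightarrow> f u \<noteq> f v}"

definition graph_chromatic_poly :: "'v set \<Rightarrow> 'v set set \<Rightarrow> int poly" where
  "graph_chromatic_poly V E =
     (THE p. \<forall>k. poly p (int k) = int (card (proper_colorings V E k)))"

text \<open>
  Each ordinary edge \<open>e\<close> carries a reference direction, from \<open>tail e\<close> to \<open>head e\<close>; the oriented edge
  \<open>(e, True)\<close> is \<open>e\<close> in that direction and \<open>(e, False)\<close> is \<open>e\<close> reversed. Loops and parallel edges are
  allowed. A half edge has its single endpoint as both tail and head, and its gain is meaningless.
\<close>

record ('v, 'e, 'g) gain_graph =
  verts :: "'v set"
  edges :: "'e set"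
  half :: "'e \<Rightarrow> bool"
  tail :: "'e \<Rightarrow> 'v"
  head :: "'e \<Rightarrow> 'v"
  gain :: "'e \<times> bool \<Rightarrow> 'g"

definition is_gain_graph :: "('g, 'm) monoid_scheme \<Rightarrow> ('v, 'e, 'g) gain_graph \<Rightarrow> bool" where
  "is_gain_graph G \<Phi> \<longleftrightarrow> group G \<and> finite (verts \<Phi>) \<and>
     (\<forall>e\<in>edges \<Phi>. tail \<Phi> e \<in> verts \<Phi> \<and> head \<Phi> e \<in> verts \<Phi> \<and>
        (if half \<Phi> e then tail \<Phi> e = head \<Phi> e
         else (\<forall>d. gain \<Phi> (e, d) \<in> carrier G \<and>
                   gain \<Phi> (e, \<not> d) = inv\<^bsub>G\<^esub> (gain \<Phi> (e, d)))))"

definition source :: "('v, 'e, 'g) gain_graph \<Rightarrow> 'e \<times> bool \<Rightarrow> 'v" where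
  "source \<Phi> a = (if snd a then tail \<Phi> (fst a) else head \<Phi> (fst a))"

definition target :: "('v, 'e, 'g) gain_graph \<Rightarrow> 'e \<times> bool \<Rightarrow> 'v" where
  "target \<Phi> a = (if snd a then head \<Phi> (fst a) else tail \<Phi> (fst a))"

text \<open>
  A circle with a starting point and a direction. Length 1 is a loop; at length 2 distinctness of the
  edges excludes going back and forth along one edge.
\<close>

definition circle :: "('v, 'e, 'g) gain_graph \<Rightarrow> 'e set \<Rightarrow> ('e \<times> bool) list \<Rightarrow> bool" where
  "circle \<Phi> S C \<longleftrightarrow> C \<noteq> [] \<and>
     (\<forall>a\<in>set C. fst a \<in> S \<and> \<not> half \<Phi> (fst a)) \<and>
     distinct (map fst C) \<and> distinct (map (source \<Phi>) C) \<and>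
     (\<forall>k<length C. target \<Phi> (C ! k) = source \<Phi> (C ! (Suc k mod length C)))"

definition circle_gain ::
  "('g, 'm) monoid_scheme \<Rightarrow> ('v, 'e, 'g) gain_graph \<Rightarrow> ('e \<times> bool) list \<Rightarrow> 'g" where
  "circle_gain G \<Phi> C = foldr (\<lambda>a x. gain \<Phi> a \<otimes>\<^bsub>G\<^esub> x) C \<one>\<^bsub>G\<^esub>"

definition balanced ::
  "('g, 'm) monoid_scheme \<Rightarrow> ('v, 'e, 'g) gain_graph \<Rightarrow> 'e set \<Rightarrow> bool" where
  "balanced G \<Phi> S \<longleftrightarrow> (\<forall>e\<in>S. \<not> half \<Phi> e) \<and>
     (\<forall>C. circle \<Phi> S C \<longrightarrow> circle_gain G \<Phi> C = \<one>\<^bsub>G\<^esub>)"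

definition components :: "('v, 'e, 'g) gain_graph \<Rightarrow> 'e set \<Rightarrow> 'v set set" where
  "components \<Phi> S = conn_classes (verts \<Phi>) {(tail \<Phi> e, head \<Phi> e) | e. e \<in> S}"

definition balanced_count ::
  "('g, 'm) monoid_scheme \<Rightarrow> ('v, 'e, 'g) gain_graph \<Rightarrow> 'e set \<Rightarrow> nat" where
  "balanced_count G \<Phi> S =
     card {B \<in> components \<Phi> S. balanced G \<Phi> {e \<in> S. tail \<Phi> e \<in> B \<and> head \<Phi> e \<in> B}}"

definition gain_chromatic_poly ::
  "('g, 'm) monoid_scheme \<Rightarrow> ('v, 'e, 'g) gain_graph \<Rightarrow> int poly" where
  "gain_chromatic_poly G \<Phi> =
     (\<Sum>S\<in>Pow (edges \<Phi>). monom ((- 1) ^ card S) (balanced_count G \<Phi> S))"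

definition signless_poly :: "nat \<Rightarrow> int poly \<Rightarrow> int poly" where
  "signless_poly n p = smult ((- 1) ^ n) (pcompose p [:0, - 1:])"

definition gain_whitney ::
  "('g, 'm) monoid_scheme \<Rightarrow> ('v, 'e, 'g) gain_graph \<Rightarrow> nat \<Rightarrow> int" where
  "gain_whitney G \<Phi> i =
     coeff (signless_poly (card (verts \<Phi>)) (gain_chromatic_poly G \<Phi>)) (card (verts \<Phi>) - i)"

definition graph_whitney :: "'v set \<Rightarrow> 'v set set \<Rightarrow> nat \<Rightarrow> int" where
  "graph_whitney V E j = coeff (signless_poly (card V) (graph_chromatic_poly V E)) (card V - j)"

definition orients :: "('v set \<Rightarrow> 'v \<times> 'v) \<Rightarrow> 'v set set \<Rightarrow> bool" where
  "orients ori E \<longleftrightarrow> (\<forall>e\<in>E. {fst (ori e), snd (ori e)} = e)"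

text \<open>\<open>Inl (g, e)\<close> is the edge \<open>ge\<close>, and \<open>Inr v\<close> is the half edge at \<open>v\<close>.\<close>

definition expansion ::
  "('g, 'm) monoid_scheme \<Rightarrow> 'v set \<Rightarrow> 'v set set \<Rightarrow> ('v set \<Rightarrow> 'v \<times> 'v) \<Rightarrow> 'v set
     \<Rightarrow> ('v, ('g \<times> 'v set) + 'v, 'g) gain_graph" where
  "expansion G V E ori X =
     \<lparr> verts = V,
       edges = Inl ` (carrier G \<times> E) \<union> Inr ` X,
       half = (\<lambda>x. case x of Inl _ \<Rightarrow> False | Inr _ \<Rightarrow> True),
       tail = (\<lambda>x. case x of Inl (g, e) \<Rightarrow> fst (ori e) | Inr v \<Rightarrow> v),
       head = (\<lambda>x. case x of Inl (g, e) \<Rightarrow> snd (ori e) | Inr v \<Rightarrow> v),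
       gain = (\<lambda>(x, d). case x of Inl (g, e) \<Rightarrow> if d then g else inv\<^bsub>G\<^esub> g | Inr _ \<Rightarrow> \<one>\<^bsub>G\<^esub>) \<rparr>"

abbreviation full_expansion ::
  "('g, 'm) monoid_scheme \<Rightarrow> 'v set \<Rightarrow> 'v set set \<Rightarrow> ('v set \<Rightarrow> 'v \<times> 'v)
     \<Rightarrow> ('v, ('g \<times> 'v set) + 'v, 'g) gain_graph" where
  "full_expansion G V E ori \<equiv> expansion G V E ori V"

lemma is_gain_graph_expansion:
  assumes "group G" "simple_graph V E" "orients ori E" "X \<subseteq> V"
  shows "is_gain_graph G (expansion G V E ori X)"
proof -
  have "fst (ori e) \<in> V \<and> snd (ori e) \<in> V" if "e \<in> E" for e
    using assms that unfolding simple_graph_def orients_def by blast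
  then show ?thesis
    using assms by (auto simp: is_gain_graph_def expansion_def simple_graph_def
        group.inv_closed group.inv_inv)
qed

lemma card_proper_colorings_contract:
  assumes sg: "simple_graph V E" and e: "{u, v} \<in> E" and uv: "u \<noteq> v"
  defines "m \<equiv> \<lambda>x. if x = v then u else x"
  shows "card {f \<in> proper_colorings V (E - {{u, v}}) k. f u = f v}
       = card (proper_colorings (V - {v}) ((`) m ` (E - {{u, v}})) k)"
    (is "card ?A = card ?B")
proof -
  have u: "u \<in> V" and v: "v \<in> V" using sg e by (auto simp: simple_graph_def)
  have "bij_betw (\<lambda>f. restrict f (V - {v})) ?A ?B"
  proof (rule bij_betw_byWitness[where f' = "\<lambda>g. g(v := g u)"])
    show "\<forall>f\<in>?A. (restrict f (V - {v}))(v := restrict f (V - {v}) u) = f"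
      using u v uv by (auto simp: proper_colorings_def PiE_iff extensional_def restrict_def fun_eq_iff)
    show "\<forall>g\<in>?B. restrict (g(v := g u)) (V - {v}) = g"
      by (auto simp: proper_colorings_def PiE_iff extensional_def restrict_def fun_eq_iff)
    show "(\<lambda>f. restrict f (V - {v})) ` ?A \<subseteq> ?B"
    proof
      fix g assume "g \<in> (\<lambda>f. restrict f (V - {v})) ` ?A"
      then obtain f where f: "f \<in> ?A" and g: "g = restrict f (V - {v})" by blast
      have fm: "f (m x) = f x" for x using f by (auto simp: m_def)
      have "g x \<noteq> g y" if xy: "x \<in> V - {v}" "y \<in> V - {v}"
        and xyE: "{x, y} \<in> (`) m ` (E - {{u, v}})" for x y
      proof -
        obtain d where d: "d \<in> E" "d \<noteq> {u, v}" "{x, y} = m ` d" using xyE by blast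
        obtain a b where ab: "d = {a, b}" using sg d(1) by (auto simp: simple_graph_def card_2_iff)
        have "a \<in> V" "b \<in> V" using sg d(1) ab by (auto simp: simple_graph_def)
        then have ne: "f a \<noteq> f b" using f d ab by (auto simp: proper_colorings_def)
        have "{f x, f y} = f ` {x, y}" by simp
        also have "\<dots> = {f a, f b}" using d(3) ab fm by (simp)
        finally have "f x \<noteq> f y" using ne by (auto simp: doubleton_eq_iff)
        then show ?thesis using g xy by simp
      qed
      moreover have "g \<in> (V - {v}) \<rightarrow>\<^sub>E {..<k}" using f g by (auto simp: proper_colorings_def)
      ultimately show "g \<in> ?B" by (simp add: proper_colorings_def)
    qed
    show "(\<lambda>g. g(v := g u)) ` ?B \<subseteq> ?A"
    proof
      fix f assume "f \<in> (\<lambda>g. g(v := g u)) ` ?B"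
      then obtain g where g: "g \<in> ?B" and f: "f = g(v := g u)" by blast
      have fm: "f x = g (m x)" for x using f uv by (simp add: m_def)
      have "f x \<noteq> f y" if xy: "x \<in> V" "y \<in> V" and d: "{x, y} \<in> E - {{u, v}}" for x y
      proof -
        have "m x \<in> V - {v}" "m y \<in> V - {v}" using xy u uv by (auto simp: m_def)
        moreover have "{m x, m y} \<in> (`) m ` (E - {{u, v}})"
          using imageI[OF d, of "(`) m"] by simp
        ultimately have "g (m x) \<noteq> g (m y)" using g unfolding proper_colorings_def by blast
        then show ?thesis by (simp add: fm)
      qed
      moreover have "f \<in> V \<rightarrow>\<^sub>E {..<k}"
        using g f u v uv by (auto simp: proper_colorings_def PiE_iff extensional_def)
      ultimately show "f \<in> ?A" using f uv by (auto simp: proper_colorings_def)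
    qed
  qed
  then show ?thesis by (rule bij_betw_same_card)
qed

lemma finite_proper_colorings: "finite V \<Longrightarrow> finite (proper_colorings V E k)"
  unfolding proper_colorings_def by (rule finite_subset[of _ "V \<rightarrow>\<^sub>E {..<k}"]) (auto intro: finite_PiE)

lemma simple_graph_finite_edges: "simple_graph V E \<Longrightarrow> finite E"
  unfolding simple_graph_def by (rule finite_subset[of _ "Pow V"]) auto

lemma chromatic_poly_exists:
  assumes "simple_graph V E"
  shows "\<exists>p :: int poly. degree p \<le> card V \<and>
           (\<forall>k. poly p (int k) = int (card (proper_colorings V E k)))"
  using assms
proof (induction "card E" arbitrary: V E rule: less_induct)
  case less
  have finV: "finite V" and finE: "finite E"
    using less.prems simple_graph_finite_edges by (auto simp: simple_graph_def)
  show ?case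
  proof (cases "E = {}")
    case True
    then have "card (proper_colorings V E k) = k ^ card V" for k
      using finV by (simp add: proper_colorings_def card_PiE)
    then show ?thesis
      by (intro exI[of _ "monom 1 (card V)"]) (simp add: poly_monom degree_monom_le)
  next
    case False
    then obtain e where e: "e \<in> E" by blast
    then obtain u v where uv: "e = {u, v}" "u \<noteq> v"
      using less.prems by (auto simp: simple_graph_def card_2_iff)
    define m where "m = (\<lambda>x. if x = v then u else x)"
    let ?E1 = "E - {{u, v}}" and ?E2 = "(`) m ` (E - {{u, v}})"
    have uV: "u \<in> V" "v \<in> V" using less.prems e uv by (auto simp: simple_graph_def)
    have c1: "card ?E1 < card E" using e uv finE by (intro psubset_card_mono) auto
    have c2: "card ?E2 < card E" using c1 card_image_le[of ?E1 "(`) m"] finE by simp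
    have s1: "simple_graph V ?E1" using less.prems by (auto simp: simple_graph_def)
    have s2: "simple_graph (V - {v}) ?E2"
    proof -
      have "m ` d \<subseteq> V - {v} \<and> card (m ` d) = 2" if d: "d \<in> E" "d \<noteq> {u, v}" for d
      proof -
        have dd: "d \<subseteq> V" "card d = 2" using less.prems d by (auto simp: simple_graph_def)
        then obtain a b where ab: "d = {a, b}" "a \<noteq> b" by (auto simp: card_2_iff)
        then have "m a \<noteq> m b" using d by (auto simp: m_def)
        then have "card (m ` d) = 2" by (simp add: ab(1))
        moreover have "m x \<in> V - {v}" if "x \<in> V" for x using that uV uv(2) by (simp add: m_def)
        ultimately show ?thesis using dd(1) by blast
      qed
      then have "\<forall>d\<in>?E2. d \<subseteq> V - {v} \<and> card d = 2" by simp
      then show ?thesis using finV by (simp add: simple_graph_def)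
    qed
    obtain p1 :: "int poly" where p1: "degree p1 \<le> card V"
      "\<And>k. poly p1 (int k) = int (card (proper_colorings V ?E1 k))"
      using less.hyps[OF c1 s1] by blast
    obtain p2 :: "int poly" where p2: "degree p2 \<le> card (V - {v})"
      "\<And>k. poly p2 (int k) = int (card (proper_colorings (V - {v}) ?E2 k))"
      using less.hyps[OF c2 s2] by blast
    have "card (V - {v}) \<le> card V" using finV by (simp add: card_mono)
    then have "degree (p1 - p2) \<le> card V" using p1(1) p2(1) by (intro degree_diff_le) auto
    moreover have "poly (p1 - p2) (int k) = int (card (proper_colorings V E k))" for k
    proof -
      let ?A = "{f \<in> proper_colorings V ?E1 k. f u = f v}"
      have eE: "{u, v} \<in> E" using e uv(1) by simp
      have iff: "f \<in> proper_colorings V E k \<longleftrightarrow> f \<in> proper_colorings V ?E1 k \<and> f u \<noteq> f v" for f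
      proof
        assume "f \<in> proper_colorings V E k"
        then show "f \<in> proper_colorings V ?E1 k \<and> f u \<noteq> f v"
          using eE uV unfolding proper_colorings_def by simp
      next
        assume f: "f \<in> proper_colorings V ?E1 k \<and> f u \<noteq> f v"
        have "f x \<noteq> f y" if "x \<in> V" "y \<in> V" "{x, y} \<in> E" for x y
        proof (cases "{x, y} = {u, v}")
          case True
          then show ?thesis using f by (metis doubleton_eq_iff)
        next
          case False
          then show ?thesis using f that unfolding proper_colorings_def by simp
        qed
        then show "f \<in> proper_colorings V E k" using f unfolding proper_colorings_def by simp
      qed
      have "proper_colorings V ?E1 k = proper_colorings V E k \<union> ?A"
        by (intro Set.set_eqI) (metis (mono_tags, lifting) Un_iff mem_Collect_eq iff)
      moreover have "proper_colorings V E k \<inter> ?A = {}"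
        by (intro equals0I) (metis (mono_tags, lifting) Int_iff mem_Collect_eq iff)
      ultimately have "card (proper_colorings V ?E1 k) = card (proper_colorings V E k) + card ?A"
        using finite_proper_colorings[OF finV] card_Un_disjoint[of "proper_colorings V E k" ?A]
        by simp
      moreover have "card ?A = card (proper_colorings (V - {v}) ?E2 k)"
        using card_proper_colorings_contract[of V E u v k] less.prems e uv by (simp add: m_def)
      ultimately show ?thesis by (simp add: p1(2) p2(2))
    qed
    ultimately show ?thesis by blast
  qed
qed

lemma int_poly_eqI_nat:
  fixes p q :: "int poly"
  assumes "\<And>k :: nat. poly p (int k) = poly q (int k)"
  shows "p = q"
proof (rule ccontr)
  assume "p \<noteq> q"
  then have "finite {x. poly (p - q) x = 0}" by (intro poly_roots_finite) simp
  moreover have "range int \<subseteq> {x. poly (p - q) x = 0}" using assms by auto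
  ultimately have "finite (range int)" by (rule rev_finite_subset)
  then show False using finite_imageD[of int UNIV] by simp
qed

lemma graph_chromatic_poly:
  assumes "simple_graph V E"
  shows poly_graph_chromatic_poly:
      "poly (graph_chromatic_poly V E) (int k) = int (card (proper_colorings V E k))"
    and degree_graph_chromatic_poly: "degree (graph_chromatic_poly V E) \<le> card V"
proof -
  obtain p :: "int poly" where p: "degree p \<le> card V"
    "\<forall>k. poly p (int k) = int (card (proper_colorings V E k))"
    using chromatic_poly_exists[OF assms] by blast
  have "graph_chromatic_poly V E = p"
    unfolding graph_chromatic_poly_def
    by (rule the_equality) (use p int_poly_eqI_nat in auto)
  then show "poly (graph_chromatic_poly V E) (int k) = int (card (proper_colorings V E k))"
    and "degree (graph_chromatic_poly V E) \<le> card V" using p by auto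
qed

lemma degree_gain_chromatic_poly:
  assumes "finite (verts \<Phi>)"
  shows "degree (gain_chromatic_poly G \<Phi>) \<le> card (verts \<Phi>)"
proof -
  have "balanced_count G \<Phi> S \<le> card (verts \<Phi>)" for S
  proof -
    have *: "components \<Phi> S = (\<lambda>x. {(u, v). u \<in> verts \<Phi> \<and> v \<in> verts \<Phi> \<and>
        (u, v) \<in> ({(tail \<Phi> e, head \<Phi> e) | e. e \<in> S} \<union> {(tail \<Phi> e, head \<Phi> e) | e. e \<in> S}\<inverse>)\<^sup>*} `` {x})
        ` verts \<Phi>"
      unfolding components_def conn_classes_def quotient_def by blast
    have "finite (components \<Phi> S)" "card (components \<Phi> S) \<le> card (verts \<Phi>)"
      unfolding * using assms by (auto intro: card_image_le)
    moreover have "balanced_count G \<Phi> S \<le> card (components \<Phi> S)"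
      unfolding balanced_count_def by (rule card_mono[OF calculation(1)]) (rule Collect_subset)
    ultimately show ?thesis by linarith
  qed
  then show ?thesis
    unfolding gain_chromatic_poly_def
    by (cases "finite (Pow (edges \<Phi>))")
      (auto intro!: degree_sum_le order_trans[OF degree_monom_le])
qed

lemma poly_eq_sum_reversed:
  fixes p :: "int poly"
  assumes "degree p \<le> n"
  shows "p = (\<Sum>i\<le>n. monom (coeff p (n - i)) (n - i))"
proof -
  have "p = (\<Sum>i\<le>n. monom (coeff p i) i)" using poly_as_sum_of_monoms'[OF assms] by simp
  also have "\<dots> = (\<Sum>i\<le>n. monom (coeff p (n - i)) (n - i))"
    by (rule sum.reindex_bij_witness[of _ "\<lambda>i. n - i" "\<lambda>i. n - i"]) auto
  finally show ?thesis .
qed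

lemma degree_signless_poly: "degree (signless_poly n p) \<le> degree p"
  unfolding signless_poly_def
  by (rule order_trans[OF degree_smult_le]) (simp add: degree_pcompose)

lemma signless_gain_chromatic_poly:
  assumes "finite (verts \<Phi>)"
  defines "n \<equiv> card (verts \<Phi>)"
  shows "signless_poly n (gain_chromatic_poly G \<Phi>) = (\<Sum>i\<le>n. monom (gain_whitney G \<Phi> i) (n - i))"
  unfolding gain_whitney_def n_def
  by (rule poly_eq_sum_reversed)
    (rule order_trans[OF degree_signless_poly degree_gain_chromatic_poly[OF assms(1)]])

lemma signless_graph_chromatic_poly:
  assumes "simple_graph V E"
  defines "n \<equiv> card V"
  shows "signless_poly n (graph_chromatic_poly V E) = (\<Sum>j\<le>n. monom (graph_whitney V E j) (n - j))"
  unfolding graph_whitney_def n_def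
  by (rule poly_eq_sum_reversed)
    (rule order_trans[OF degree_signless_poly degree_graph_chromatic_poly[OF assms(1)]])

end

theory Submission
  imports Defs
begin

text \<open>
  Color the vertices of a gain graph \<open>\<Phi>\<close> by a zero color and the elements of \<open>G \<times> {0,\<dots>,k-1}\<close>, on which
  \<open>G\<close> acts freely. The colorings that are improper on every edge of \<open>S\<close> are determined by one arbitrary
  color per balanced component of \<open>S\<close>, and vanish on the unbalanced components, so there are
  \<open>(1 + \<gamma>k)^b(S)\<close> of them; by inclusion-exclusion \<open>\<chi>\<^sub>\<Phi>(1 + \<gamma>k)\<close> counts the proper colorings. In the full
  expansion the half edges forbid zero, and the edges \<open>ge\<close> together say that the second components at the
  ends of \<open>e\<close> differ, while the group components are free. Hence
  \<open>\<chi>(1 + \<gamma>k) = \<gamma>^n \<chi>\<^sub>\<Gamma>(k)\<close>, and expanding in powers of \<open>\<lambda>\<close> gives the formula. Deletion and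
  contraction show that \<open>w\<^sub>j(\<Gamma>)\<close> is positive for \<open>j \<le> n - c\<close> and zero beyond.
\<close>

section \<open>Balance and potentials\<close>

text \<open>\<open>is_gain_graph\<close> bounds only the vertex set; finitely many edges are what
  the induction over edge sets and the alternating sum over \<open>Pow (edges \<Phi>)\<close> rest
  on.\<close>

locale finite_gain_graph = group G for G (structure) +
  fixes \<Phi> :: "('v, 'e, 'a) gain_graph"
  assumes gain_graph: "is_gain_graph G \<Phi>"
    and finite_edges: "finite (edges \<Phi>)"
begin

definition adjacent :: "'e set \<Rightarrow> ('v \<times> 'v) set" where
  "adjacent S = {(tail \<Phi> e, head \<Phi> e) | e. e \<in> S} \<union> {(tail \<Phi> e, head \<Phi> e) | e. e \<in> S}\<inverse>"

definition ordinary :: "'e set \<Rightarrow> bool" where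
  "ordinary S \<longleftrightarrow> S \<subseteq> edges \<Phi> \<and> (\<forall>e\<in>S. \<not> half \<Phi> e)"

lemma finite_verts: "finite (verts \<Phi>)"
  using gain_graph by (simp add: is_gain_graph_def)

lemma tail_in_verts: "e \<in> edges \<Phi> \<Longrightarrow> tail \<Phi> e \<in> verts \<Phi>"
  and head_in_verts: "e \<in> edges \<Phi> \<Longrightarrow> head \<Phi> e \<in> verts \<Phi>"
  using gain_graph by (auto simp: is_gain_graph_def)

lemma gain_closed: "e \<in> edges \<Phi> \<Longrightarrow> \<not> half \<Phi> e \<Longrightarrow> gain \<Phi> (e, d) \<in> carrier G"
  using gain_graph by (auto simp: is_gain_graph_def)

lemma gain_False: "e \<in> edges \<Phi> \<Longrightarrow> \<not> half \<Phi> e \<Longrightarrow> gain \<Phi> (e, False) = inv (gain \<Phi> (e, True))"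
  using gain_graph unfolding is_gain_graph_def by (metis (full_types))

lemma sym_adjacent: "sym (adjacent S)"
  by (auto simp: adjacent_def sym_def)

lemma adjacent_rtrancl_sym: "(x, y) \<in> (adjacent S)\<^sup>* \<Longrightarrow> (y, x) \<in> (adjacent S)\<^sup>*"
  using sym_rtrancl[OF sym_adjacent] by (rule symD)

lemma adjacentE:
  assumes "(x, y) \<in> adjacent S"
  obtains a where "fst a \<in> S" "source \<Phi> a = x" "target \<Phi> a = y"
proof -
  from assms consider e where "e \<in> S" "x = tail \<Phi> e" "y = head \<Phi> e"
    | e where "e \<in> S" "x = head \<Phi> e" "y = tail \<Phi> e"
    by (auto simp: adjacent_def)
  then show thesis
  proof cases
    case 1
    then show thesis using that[of "(e, True)"] by (simp add: source_def target_def)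
  next
    case 2
    then show thesis using that[of "(e, False)"] by (simp add: source_def target_def)
  qed
qed

section \<open>Walks, and circles as closed simple walks\<close>

fun walk :: "'e set \<Rightarrow> 'v \<Rightarrow> ('e \<times> bool) list \<Rightarrow> 'v \<Rightarrow> bool" where
  "walk S u [] v \<longleftrightarrow> u = v"
| "walk S u (a # p) v \<longleftrightarrow> fst a \<in> S \<and> source \<Phi> a = u \<and> walk S (target \<Phi> a) p v"

lemma walk_suffix: "walk S u (p @ q) v \<Longrightarrow> \<exists>w. walk S w q v"
  by (induction p arbitrary: u) auto

text \<open>The sources of the edges followed by \<open>v\<close> list the vertices of the walk, so
  the distinctness says that no vertex repeats. Edges are prepended one at a time; if the new start
  already lies on the walk, the walk is cut back to that occurrence.\<close>

lemma simple_walk_exists: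
  assumes "(u, v) \<in> (adjacent S)\<^sup>*"
  shows "\<exists>p. walk S u p v \<and> distinct (map (source \<Phi>) p @ [v])"
  using assms
proof (induction rule: converse_rtrancl_induct)
  case base
  show ?case by (intro exI[of _ "[]"]) simp
next
  case (step x y)
  then obtain p where p: "walk S y p v" "distinct (map (source \<Phi>) p @ [v])" by blast
  obtain a where a: "fst a \<in> S" "source \<Phi> a = x" "target \<Phi> a = y"
    using step.hyps(1) by (rule adjacentE)
  consider "x = v" | "x \<noteq> v" "x \<in> set (map (source \<Phi>) p)" | "x \<notin> set (map (source \<Phi>) p @ [v])"
    by auto
  then show ?case
  proof cases
    case 1
    then show ?thesis by (intro exI[of _ "[]"]) simp
  next
    case 2
    then obtain b where b: "b \<in> set p" "source \<Phi> b = x" by auto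
    then obtain q r where qr: "p = q @ b # r" by (meson split_list)
    then have "walk S x (b # r) v" using walk_suffix[of S y q "b # r" v] p(1) b(2) by auto
    then show ?thesis using p(2) qr by (intro exI[of _ "b # r"]) simp
  next
    case 3
    then show ?thesis using p a by (intro exI[of _ "a # p"]) auto
  qed
qed

lemma walk_endpoints:
  assumes "walk S u p v" "a \<in> set p"
  shows "{tail \<Phi> (fst a), head \<Phi> (fst a)} \<subseteq> set (map (source \<Phi>) p @ [v])" "fst a \<in> S"
proof -
  have start: "u \<in> set (map (source \<Phi>) p @ [v])" if "walk S u p v" for u p
    using that by (cases p) auto
  show "{tail \<Phi> (fst a), head \<Phi> (fst a)} \<subseteq> set (map (source \<Phi>) p @ [v])"
    using assms
  proof (induction p arbitrary: u)
    case (Cons b p)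
    show ?case
    proof (cases "a = b")
      case True
      have "{tail \<Phi> (fst b), head \<Phi> (fst b)} = {source \<Phi> b, target \<Phi> b}"
        by (auto simp: source_def target_def)
      moreover have "target \<Phi> b \<in> set (map (source \<Phi>) p @ [v])"
        using Cons.prems(1) by (intro start) simp
      ultimately show ?thesis using True by auto
    next
      case False
      then show ?thesis using Cons.IH[of "target \<Phi> b"] Cons.prems by auto
    qed
  qed simp
  show "fst a \<in> S" using assms by (induction p arbitrary: u) auto
qed

text \<open>If the first edge occurred again, in either direction, its source would be an endpoint
  of a later edge and hence a repeated vertex.\<close>

lemma simple_walk_distinct_edges:
  assumes "walk S u p v" "distinct (map (source \<Phi>) p @ [v])"
  shows "distinct (map fst p)"
  using assms
proof (induction p arbitrary: u)
  case (Cons a p)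
  have w: "walk S (target \<Phi> a) p v" using Cons.prems by simp
  have "fst a \<notin> fst ` set p"
  proof
    assume "fst a \<in> fst ` set p"
    then obtain b where b: "b \<in> set p" "fst b = fst a" by auto
    have "source \<Phi> a \<in> {tail \<Phi> (fst b), head \<Phi> (fst b)}" using b(2) by (auto simp: source_def)
    then have "source \<Phi> a \<in> set (map (source \<Phi>) p @ [v])" using walk_endpoints(1)[OF w b(1)] by blast
    then show False using Cons.prems(2) by auto
  qed
  then show ?case using Cons.IH[OF w] Cons.prems(2) by simp
qed simp

lemma walk_nth:
  assumes "walk S u p v" "k < length p"
  shows "target \<Phi> (p ! k) = (if Suc k < length p then source \<Phi> (p ! Suc k) else v)"
  using assms
proof (induction p arbitrary: u k)
  case (Cons a p)
  show ?case
  proof (cases k)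
    case 0
    then show ?thesis using Cons.prems by (cases p) auto
  next
    case (Suc j)
    then show ?thesis using Cons.IH[of "target \<Phi> a" j] Cons.prems by simp
  qed
qed simp

text \<open>At the last edge the cyclic index \<open>Suc k mod length p\<close> is 0, and the final
  vertex \<open>u\<close> of the walk is the source of its first edge.\<close>

lemma circle_closed_walk:
  assumes "walk S u p u" "p \<noteq> []" "\<forall>e\<in>S. \<not> half \<Phi> e"
    and "distinct (map fst p)" "distinct (map (source \<Phi>) p)"
  shows "circle \<Phi> S p"
proof -
  have "target \<Phi> (p ! k) = source \<Phi> (p ! (Suc k mod length p))" if k: "k < length p" for k
  proof (cases "Suc k < length p")
    case True
    then show ?thesis using walk_nth[OF assms(1) k] by simp
  next
    case False
    then have "Suc k = length p" using k by simp
    then show ?thesis using walk_nth[OF assms(1) k] assms(1,2) by (cases p) auto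
  qed
  then show ?thesis using assms walk_endpoints(2)[OF assms(1)] by (auto simp: circle_def)
qed

section \<open>Potentials: vertex labels whose quotients are the gains\<close>

lemma oriented_potential:
  assumes "ordinary S" "\<And>v. \<theta> v \<in> carrier G"
    and "\<And>e. e \<in> S \<Longrightarrow> \<theta> (head \<Phi> e) = \<theta> (tail \<Phi> e) \<otimes> gain \<Phi> (e, True)"
    and "fst a \<in> S"
  shows "gain \<Phi> a \<in> carrier G" "\<theta> (target \<Phi> a) = \<theta> (source \<Phi> a) \<otimes> gain \<Phi> a"
proof -
  obtain e d where a: "a = (e, d)" by (cases a)
  have e: "e \<in> S" "e \<in> edges \<Phi>" "\<not> half \<Phi> e" using assms(1,4) a by (auto simp: ordinary_def)
  show "gain \<Phi> a \<in> carrier G" using gain_closed e a by simp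
  show "\<theta> (target \<Phi> a) = \<theta> (source \<Phi> a) \<otimes> gain \<Phi> a"
    using a assms(2) assms(3)[OF e(1)] gain_False[OF e(2,3)] gain_closed[OF e(2,3)]
    by (cases d) (auto simp: source_def target_def m_assoc)
qed

text \<open>The gains telescope along the walk.\<close>

lemma walk_potential:
  assumes "ordinary S" "\<And>v. \<theta> v \<in> carrier G"
    and "\<And>e. e \<in> S \<Longrightarrow> \<theta> (head \<Phi> e) = \<theta> (tail \<Phi> e) \<otimes> gain \<Phi> (e, True)"
    and "walk S u p v"
  shows "circle_gain G \<Phi> p \<in> carrier G \<and> \<theta> v = \<theta> u \<otimes> circle_gain G \<Phi> p"
  using assms(4)
proof (induction p arbitrary: u)
  case Nil
  then show ?case using assms(2) by (simp add: circle_gain_def)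
next
  case (Cons a p)
  then have "fst a \<in> S" by simp
  note op = oriented_potential[of S \<theta>, OF assms(1-3) this]
  show ?case using Cons.IH[of "target \<Phi> a"] Cons.prems op assms(2)
    by (auto simp: circle_gain_def m_assoc)
qed

lemma balanced_subset: "balanced G \<Phi> S \<Longrightarrow> T \<subseteq> S \<Longrightarrow> balanced G \<Phi> T"
  unfolding balanced_def circle_def by blast

text \<open>A potential makes the gain between two vertices of a balanced component independent of
  the route. This is what later allows a coloring of the component to be written down from one
  color. The proof adds the edges one by one.\<close>

lemma balanced_potential_exists:
  assumes "S \<subseteq> edges \<Phi>" "balanced G \<Phi> S"
  shows "\<exists>\<theta>. (\<forall>v. \<theta> v \<in> carrier G) \<and>
    (\<forall>e\<in>S. \<theta> (head \<Phi> e) = \<theta> (tail \<Phi> e) \<otimes> gain \<Phi> (e, True))"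
proof -
  have "finite S" using assms(1) finite_edges by (rule finite_subset)
  then show ?thesis using assms
  proof (induction S)
    case empty
    show ?case by (intro exI[of _ "\<lambda>_. \<one>"]) simp
  next
    case (insert e S)
    have ord: "ordinary S" "ordinary (insert e S)"
      using insert.prems by (auto simp: ordinary_def balanced_def)
    have g: "gain \<Phi> (e, True) \<in> carrier G" using ord(2) by (auto simp: ordinary_def intro: gain_closed)
    have "balanced G \<Phi> S" using insert.prems(2) by (rule balanced_subset) blast
    then obtain \<theta> where \<theta>: "\<And>v. \<theta> v \<in> carrier G"
      "\<And>e. e \<in> S \<Longrightarrow> \<theta> (head \<Phi> e) = \<theta> (tail \<Phi> e) \<otimes> gain \<Phi> (e, True)"
      using insert.IH insert.prems by blast
    let ?t = "tail \<Phi> e" and ?h = "head \<Phi> e"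
    \<comment> \<open>An edge inside a component of the rest closes a circle; an edge between two components is
      accommodated by translating the potential on one of them.\<close>
    show ?case
    proof (cases "(?h, ?t) \<in> (adjacent S)\<^sup>*")
      case True
      \<comment> \<open>If \<open>e\<close> is a loop, \<open>p\<close> may be empty, and the circle
        below is \<open>e\<close> alone.\<close>
      then obtain p where p: "walk S ?h p ?t" "distinct (map (source \<Phi>) p @ [?t])"
        using simple_walk_exists by blast
      let ?C = "(e, True) # p"
      have mono: "walk (insert e S) u p v" if "walk S u p v" for u v
        using that by (induction p arbitrary: u) auto
      have "circle \<Phi> (insert e S) ?C"
      proof (rule circle_closed_walk)
        show "walk (insert e S) ?t ?C ?t" using p(1) mono by (simp add: source_def target_def)
        show "distinct (map fst ?C)"
          using simple_walk_distinct_edges[OF p] walk_endpoints(2)[OF p(1)] insert.hyps by auto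
        show "distinct (map (source \<Phi>) ?C)" using p(2) by (auto simp: source_def)
      qed (use ord(2) in \<open>auto simp: ordinary_def\<close>)
      then have "circle_gain G \<Phi> ?C = \<one>" using insert.prems(2) by (simp add: balanced_def)
      then have one: "gain \<Phi> (e, True) \<otimes> circle_gain G \<Phi> p = \<one>" by (simp add: circle_gain_def)
      have wp: "circle_gain G \<Phi> p \<in> carrier G" "\<theta> ?t = \<theta> ?h \<otimes> circle_gain G \<Phi> p"
        using walk_potential[of S \<theta>, OF ord(1) \<theta> p(1)] by auto
      have "gain \<Phi> (e, True) = inv (circle_gain G \<Phi> p)"
        using one g wp(1) by (metis inv_equality)
      then have "\<theta> ?h = \<theta> ?t \<otimes> gain \<Phi> (e, True)" using wp \<theta>(1) by (simp add: m_assoc)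
      then show ?thesis using \<theta> by (intro exI[of _ \<theta>]) auto
    next
      case False
      \<comment> \<open>Gains multiply on the right, so left translation by \<open>k\<close> on the
        component of \<open>?h\<close> keeps the equations on \<open>S\<close>; \<open>k\<close>
        solves the equation on \<open>e\<close>, whose tail lies outside that component.\<close>
      define k where "k = \<theta> ?t \<otimes> gain \<Phi> (e, True) \<otimes> inv (\<theta> ?h)"
      have k: "k \<in> carrier G" using \<theta>(1) g by (simp add: k_def)
      define \<eta> where "\<eta> x = (if (?h, x) \<in> (adjacent S)\<^sup>* then k \<otimes> \<theta> x else \<theta> x)" for x
      have "\<eta> (head \<Phi> d) = \<eta> (tail \<Phi> d) \<otimes> gain \<Phi> (d, True)" if d: "d \<in> S" for d
      proof -
        have "(tail \<Phi> d, head \<Phi> d) \<in> adjacent S" "(head \<Phi> d, tail \<Phi> d) \<in> adjacent S"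
          using d by (auto simp: adjacent_def)
        then have "(?h, tail \<Phi> d) \<in> (adjacent S)\<^sup>* \<longleftrightarrow> (?h, head \<Phi> d) \<in> (adjacent S)\<^sup>*"
          by (meson rtrancl.rtrancl_into_rtrancl)
        moreover have "gain \<Phi> (d, True) \<in> carrier G"
          using d ord(1) by (auto simp: ordinary_def intro: gain_closed)
        ultimately show ?thesis using \<theta> d k by (simp add: \<eta>_def m_assoc)
      qed
      moreover have "\<eta> ?h = \<eta> ?t \<otimes> gain \<Phi> (e, True)"
        using False \<theta>(1) g by (simp add: \<eta>_def k_def m_assoc)
      moreover have "\<eta> v \<in> carrier G" for v using \<theta>(1) k by (simp add: \<eta>_def)
      ultimately show ?thesis by (intro exI[of _ \<eta>]) auto
    qed
  qed
qed

end

section \<open>Colorings of gain graphs\<close>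

context finite_gain_graph
begin

text \<open>The color \<open>None\<close> is the zero color, fixed by the action.\<close>

definition act :: "('a \<times> nat) option \<Rightarrow> 'a \<Rightarrow> ('a \<times> nat) option" where
  "act x g = map_option (\<lambda>(h, i). (h \<otimes> g, i)) x"

definition colors :: "nat \<Rightarrow> ('a \<times> nat) option set" where
  "colors k = insert None (Some ` (carrier G \<times> {..<k}))"

text \<open>A half edge behaves like a loop with nontrivial gain: it is improper exactly at the zero
  color. Both sources of imbalance thus have the same effect on colorings.\<close>

definition improper :: "('v \<Rightarrow> ('a \<times> nat) option) \<Rightarrow> 'e \<Rightarrow> bool" where
  "improper f e \<longleftrightarrow>
     (if half \<Phi> e then f (tail \<Phi> e) = None
      else f (head \<Phi> e) = act (f (tail \<Phi> e)) (gain \<Phi> (e, True)))"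

definition improper_colorings :: "nat \<Rightarrow> 'e set \<Rightarrow> ('v \<Rightarrow> ('a \<times> nat) option) set" where
  "improper_colorings k S = {f \<in> verts \<Phi> \<rightarrow>\<^sub>E colors k. \<forall>e\<in>S. improper f e}"

lemma act_closed: "x \<in> colors k \<Longrightarrow> g \<in> carrier G \<Longrightarrow> act x g \<in> colors k"
  by (auto simp: act_def colors_def)

lemma act_act:
  "x \<in> colors k \<Longrightarrow> g \<in> carrier G \<Longrightarrow> h \<in> carrier G \<Longrightarrow> act (act x g) h = act x (g \<otimes> h)"
  by (auto simp: act_def colors_def m_assoc)

lemma act_one: "x \<in> colors k \<Longrightarrow> act x \<one> = x"
  by (auto simp: act_def colors_def)

text \<open>Freeness of the action on nonzero colors, by cancellation. It is the reason why a circle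
  that is not neutral forces the zero color.\<close>

lemma act_fixed: "x \<in> colors k \<Longrightarrow> g \<in> carrier G \<Longrightarrow> act x g = x \<Longrightarrow> g \<noteq> \<one> \<Longrightarrow> x = None"
  by (auto simp: act_def colors_def)

lemma act_None [simp]: "act None g = None" "act x g = None \<longleftrightarrow> x = None"
  by (auto simp: act_def)

lemma improper_oriented:
  assumes f: "f \<in> verts \<Phi> \<rightarrow>\<^sub>E colors k" and e: "fst a \<in> edges \<Phi>" "\<not> half \<Phi> (fst a)"
    and imp: "improper f (fst a)"
  shows "f (target \<Phi> a) = act (f (source \<Phi> a)) (gain \<Phi> a)"
proof -
  obtain e d where a: "a = (e, d)" by (cases a)
  have col: "f (tail \<Phi> e) \<in> colors k" "f (head \<Phi> e) \<in> colors k"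
    using f e a tail_in_verts head_in_verts by (auto simp: PiE_iff)
  have h: "f (head \<Phi> e) = act (f (tail \<Phi> e)) (gain \<Phi> (e, True))"
    using imp e a by (simp add: improper_def)
  have g: "gain \<Phi> (e, True) \<in> carrier G" using gain_closed e a by simp
  have "f (tail \<Phi> e) = act (f (head \<Phi> e)) (gain \<Phi> (e, False))"
    using h g col e a gain_False[of e] by (simp add: act_act[of _ k] act_one[of _ k])
  then show ?thesis using h a by (cases d) (simp_all add: source_def target_def)
qed

text \<open>Each improper edge transports the color by its gain, so after a full turn the starting
  color has been multiplied by the gain of the circle and must be the same again.\<close>

lemma circle_fixes_color:
  assumes f: "f \<in> improper_colorings k S" and S: "S \<subseteq> edges \<Phi>" and C: "circle \<Phi> S C"
  shows "circle_gain G \<Phi> C \<in> carrier G"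
    "act (f (source \<Phi> (C ! 0))) (circle_gain G \<Phi> C) = f (source \<Phi> (C ! 0))"
    "source \<Phi> (C ! 0) \<in> verts \<Phi>"
proof -
  let ?u = "source \<Phi> (C ! 0)"
  have f': "f \<in> verts \<Phi> \<rightarrow>\<^sub>E colors k" and imp: "\<And>e. e \<in> S \<Longrightarrow> improper f e"
    using f by (auto simp: improper_colorings_def)
  have e: "fst (C ! j) \<in> S" "\<not> half \<Phi> (fst (C ! j))" "fst (C ! j) \<in> edges \<Phi>" if "j < length C" for j
    using C S that nth_mem[OF that] by (auto simp: circle_def)
  have gc: "gain \<Phi> (C ! j) \<in> carrier G" if "j < length C" for j
    using gain_closed[OF e(3,2)[OF that]] by (metis prod.collapse)
  have gs: "gain \<Phi> b \<in> carrier G" if "b \<in> set C" for b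
    using gc that by (metis in_set_conv_nth)
  have l: "0 < length C" using C by (auto simp: circle_def)
  show u: "?u \<in> verts \<Phi>"
    using e(3)[OF l] tail_in_verts head_in_verts by (auto simp: source_def)
  then have fu: "f ?u \<in> colors k" using f' by auto
  \<comment> \<open>\<open>circle_gain\<close> folds from the right, whereas the induction below
    lengthens prefixes at their end.\<close>
  have snoc: "circle_gain G \<Phi> (p @ [a]) = circle_gain G \<Phi> p \<otimes> gain \<Phi> a \<and>
      circle_gain G \<Phi> p \<in> carrier G"
    if "\<forall>b\<in>set (p @ [a]). gain \<Phi> b \<in> carrier G" for p a
    using that by (induction p) (auto simp: circle_gain_def m_assoc)
  \<comment> \<open>The index is reduced modulo the length so that \<open>j = length C\<close>
    refers to the starting vertex again.\<close>
  have "circle_gain G \<Phi> (take j C) \<in> carrier G \<and>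
      f (source \<Phi> (C ! (j mod length C))) = act (f ?u) (circle_gain G \<Phi> (take j C))"
    if "j \<le> length C" for j
    using that
  proof (induction j)
    case 0
    then show ?case using fu by (simp add: circle_gain_def act_one)
  next
    case (Suc j)
    then have j: "j < length C" by simp
    have "\<forall>b\<in>set (take j C @ [C ! j]). gain \<Phi> b \<in> carrier G"
      using gs in_set_takeD gc[OF j] by fastforce
    note s = snoc[OF this]
    have "f (source \<Phi> (C ! (Suc j mod length C))) = f (target \<Phi> (C ! j))"
      using C j by (simp add: circle_def)
    also have "\<dots> = act (f (source \<Phi> (C ! j))) (gain \<Phi> (C ! j))"
      using improper_oriented[OF f' e(3,2)[OF j] imp[OF e(1)[OF j]]] .
    also have "\<dots> = act (f ?u) (circle_gain G \<Phi> (take j C) \<otimes> gain \<Phi> (C ! j))"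
      using Suc.IH j fu gc[OF j] by (simp add: act_act)
    finally show ?case using s gc[OF j] j by (simp add: take_Suc_conv_app_nth)
  qed
  from this[of "length C"] show "circle_gain G \<Phi> C \<in> carrier G"
    "act (f ?u) (circle_gain G \<Phi> C) = f ?u" using l by auto
qed

definition conn :: "'e set \<Rightarrow> ('v \<times> 'v) set" where
  "conn S = {(u, v). u \<in> verts \<Phi> \<and> v \<in> verts \<Phi> \<and> (u, v) \<in> (adjacent S)\<^sup>*}"

lemma components_conn: "components \<Phi> S = verts \<Phi> // conn S"
  by (simp add: components_def conn_classes_def conn_def adjacent_def)

lemma equiv_conn: "equiv (verts \<Phi>) (conn S)"
proof (rule equivI)
  show "conn S \<subseteq> verts \<Phi> \<times> verts \<Phi>" by (auto simp: conn_def)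
  show "refl_on (verts \<Phi>) (conn S)" by (auto simp: conn_def refl_on_def)
  show "sym (conn S)" by (auto simp: conn_def sym_def intro: adjacent_rtrancl_sym)
  show "trans (conn S)" by (auto simp: conn_def trans_def)
qed

text \<open>An improper ordinary edge determines the color at each end from the color at the other,
  so agreement spreads; a half edge only joins a vertex to itself.\<close>

lemma improper_agree_connected:
  assumes f: "f \<in> improper_colorings k S" and f': "f' \<in> improper_colorings k S"
    and S: "S \<subseteq> edges \<Phi>"
    and xy: "(x, y) \<in> (adjacent S)\<^sup>*" and "f x = f' x"
  shows "f y = f' y"
  using xy
proof (induction rule: rtrancl_induct)
  case base
  show ?case by fact
next
  case (step y z)
  obtain a where a: "fst a \<in> S" "source \<Phi> a = y" "target \<Phi> a = z"
    using step.hyps(2) by (rule adjacentE)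
  then have e: "fst a \<in> edges \<Phi>" using S by auto
  have F: "f \<in> verts \<Phi> \<rightarrow>\<^sub>E colors k" "f' \<in> verts \<Phi> \<rightarrow>\<^sub>E colors k" "improper f (fst a)" "improper f' (fst a)"
    using f f' a by (auto simp: improper_colorings_def)
  show ?case
  proof (cases "half \<Phi> (fst a)")
    case True
    then have "tail \<Phi> (fst a) = head \<Phi> (fst a)" using gain_graph e by (auto simp: is_gain_graph_def)
    then have "y = z" using a by (auto simp: source_def target_def)
    then show ?thesis using step.IH by simp
  next
    case False
    then show ?thesis using improper_oriented[OF F(1) e False F(3)] improper_oriented[OF F(2) e False F(4)]
      step.IH a by simp
  qed
qed

lemma zero_improper: "S \<subseteq> edges \<Phi> \<Longrightarrow> restrict (\<lambda>_. None) (verts \<Phi>) \<in> improper_colorings k S"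
  using tail_in_verts head_in_verts
  by (auto simp: improper_colorings_def colors_def improper_def subset_iff)

text \<open>A half edge, or a circle that is not neutral, produces one vertex of color zero in
  \<open>B\<close>. Comparison with the zero coloring, which is improper everywhere, spreads this
  over the component.\<close>

lemma unbalanced_zero:
  assumes f: "f \<in> improper_colorings k S" and S: "S \<subseteq> edges \<Phi>"
    and B: "B \<in> components \<Phi> S"
    and nb: "\<not> balanced G \<Phi> {e \<in> S. tail \<Phi> e \<in> B \<and> head \<Phi> e \<in> B}" (is "\<not> balanced G \<Phi> ?SB")
    and v: "v \<in> B"
  shows "f v = None"
proof -
  have f': "f \<in> verts \<Phi> \<rightarrow>\<^sub>E colors k" and imp: "\<And>e. e \<in> S \<Longrightarrow> improper f e"
    using f by (auto simp: improper_colorings_def)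
  have "\<exists>u\<in>B. f u = None"
  proof (cases "\<exists>e\<in>?SB. half \<Phi> e")
    case True
    then obtain e where "e \<in> ?SB" "half \<Phi> e" by blast
    then show ?thesis using imp[of e] by (auto simp: improper_def)
  next
    case False
    then obtain C where C: "circle \<Phi> ?SB C" "circle_gain G \<Phi> C \<noteq> \<one>"
      using nb by (auto simp: balanced_def)
    have fSB: "f \<in> improper_colorings k ?SB" using f by (auto simp: improper_colorings_def)
    have SB: "?SB \<subseteq> edges \<Phi>" using S by auto
    note c = circle_fixes_color[OF fSB SB C(1)]
    have "f (source \<Phi> (C ! 0)) = None"
      using act_fixed[of "f (source \<Phi> (C ! 0))" k] c C(2) f' by auto
    moreover have "fst (C ! 0) \<in> ?SB" using C(1) by (auto simp: circle_def)
    then have "source \<Phi> (C ! 0) \<in> B" by (auto simp: source_def)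
    ultimately show ?thesis by blast
  qed
  then obtain u where u: "u \<in> B" "f u = None" by blast
  have "(u, v) \<in> conn S"
    using B u(1) v quotient_eq_iff[OF equiv_conn] by (simp add: components_conn) blast
  then have uv: "(u, v) \<in> (adjacent S)\<^sup>*" "u \<in> verts \<Phi>" "v \<in> verts \<Phi>" by (auto simp: conn_def)
  have "f v = restrict (\<lambda>_. None) (verts \<Phi>) v"
    using improper_agree_connected[OF f zero_improper[OF S] S uv(1)] u(2) uv(2) by simp
  then show ?thesis using uv(3) by simp
qed

text \<open>Reading off the color at one representative of each balanced component is a bijection
  onto \<open>Bal \<rightarrow>\<^sub>E colors k\<close>. Connectedness and
  \<open>unbalanced_zero\<close> give injectivity; potentials give surjectivity.\<close>

lemma card_improper_colorings:
  assumes S: "S \<subseteq> edges \<Phi>"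
  shows "card (improper_colorings k S) = card (colors k) ^ balanced_count G \<Phi> S"
proof -
  define Bal where "Bal = {B \<in> components \<Phi> S. balanced G \<Phi> {e \<in> S. tail \<Phi> e \<in> B \<and> head \<Phi> e \<in> B}}"
  have finC: "finite (components \<Phi> S)"
    using finite_verts equiv_conn by (simp add: components_conn finite_quotient equiv_type)
  then have finB: "finite Bal" by (simp add: Bal_def)
  define r where "r B = (SOME x. x \<in> B)" for B :: "'v set"
  have r: "r B \<in> B" if "B \<in> components \<Phi> S" for B
    unfolding r_def
    by (rule someI_ex) (use that in_quotient_imp_non_empty[OF equiv_conn] in \<open>auto simp: components_conn\<close>)
  have sub: "B \<subseteq> verts \<Phi>" if "B \<in> components \<Phi> S" for B
    using that in_quotient_imp_subset[OF equiv_conn] by (auto simp: components_conn)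
  define cl where "cl v = conn S `` {v}" for v
  have cl: "cl v \<in> components \<Phi> S" "v \<in> cl v" if "v \<in> verts \<Phi>" for v
    using that equiv_class_self[OF equiv_conn that] by (auto simp: cl_def components_conn quotientI)
  have cl_eq: "cl v = B" if "B \<in> components \<Phi> S" "v \<in> B" for v B
    using that cl[of v] sub[of B] quotient_disj[OF equiv_conn, of B S "cl v"]
    by (auto simp: components_conn)
  have rv: "(r (cl v), v) \<in> (adjacent S)\<^sup>*" if "v \<in> verts \<Phi>" for v
    using r[OF cl(1)[OF that]] by (auto simp: cl_def conn_def intro: adjacent_rtrancl_sym)
  have "\<exists>\<theta>. (\<forall>v. \<theta> v \<in> carrier G) \<and>
      (\<forall>e\<in>{e \<in> S. tail \<Phi> e \<in> B \<and> head \<Phi> e \<in> B}. \<theta> (head \<Phi> e) = \<theta> (tail \<Phi> e) \<otimes> gain \<Phi> (e, True))"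
    if "B \<in> Bal" for B
    by (rule balanced_potential_exists) (use S that in \<open>auto simp: Bal_def\<close>)
  then have "\<exists>\<theta>. \<forall>B\<in>Bal. (\<forall>v. \<theta> B v \<in> carrier G) \<and>
      (\<forall>e\<in>{e \<in> S. tail \<Phi> e \<in> B \<and> head \<Phi> e \<in> B}.
         \<theta> B (head \<Phi> e) = \<theta> B (tail \<Phi> e) \<otimes> gain \<Phi> (e, True))"
    by (intro bchoice) blast
  then obtain \<theta> where \<theta>: "\<And>B v. B \<in> Bal \<Longrightarrow> \<theta> B v \<in> carrier G"
    "\<And>B e. B \<in> Bal \<Longrightarrow> e \<in> S \<Longrightarrow> tail \<Phi> e \<in> B \<Longrightarrow> head \<Phi> e \<in> B \<Longrightarrow>
       \<theta> B (head \<Phi> e) = \<theta> B (tail \<Phi> e) \<otimes> gain \<Phi> (e, True)"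
    by blast
  let ?F = "\<lambda>f. restrict (\<lambda>B. f (r B)) Bal"
  have "inj_on ?F (improper_colorings k S)"
  proof (rule inj_onI)
    fix f f' assume f: "f \<in> improper_colorings k S" and f': "f' \<in> improper_colorings k S"
      and eq: "?F f = ?F f'"
    have "f v = f' v" if v: "v \<in> verts \<Phi>" for v
    proof (cases "cl v \<in> Bal")
      case True
      then have "f (r (cl v)) = f' (r (cl v))" using fun_cong[OF eq, of "cl v"] by simp
      then show ?thesis by (rule improper_agree_connected[OF f f' S rv[OF v]])
    next
      case False
      then have "\<not> balanced G \<Phi> {e \<in> S. tail \<Phi> e \<in> cl v \<and> head \<Phi> e \<in> cl v}"
        using cl(1)[OF v] by (simp add: Bal_def)
      then show ?thesis using unbalanced_zero[OF f S cl(1)[OF v] _ cl(2)[OF v]]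
          unbalanced_zero[OF f' S cl(1)[OF v] _ cl(2)[OF v]] by simp
    qed
    then show "f = f'"
      using f f' by (intro PiE_ext[of f "verts \<Phi>" "\<lambda>_. colors k"]) (auto simp: improper_colorings_def)
  qed
  moreover have "?F ` improper_colorings k S = (Bal \<rightarrow>\<^sub>E colors k)"
  proof
    show "?F ` improper_colorings k S \<subseteq> Bal \<rightarrow>\<^sub>E colors k"
      using r sub by (fastforce simp: improper_colorings_def Bal_def PiE_iff)
    show "Bal \<rightarrow>\<^sub>E colors k \<subseteq> ?F ` improper_colorings k S"
    proof
      fix g assume g: "g \<in> Bal \<rightarrow>\<^sub>E colors k"
      \<comment> \<open>The color prescribed at the representative is moved by the potential
        relative to it. The relative potential is \<open>\<one>\<close> at the representative, so
        \<open>f\<close> restricts to \<open>g\<close> there, and along an edge it grows by the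
        gain, so the edge is improper.\<close>
      define f where "f = restrict (\<lambda>v. if cl v \<in> Bal
        then act (g (cl v)) (inv (\<theta> (cl v) (r (cl v))) \<otimes> \<theta> (cl v) v) else None) (verts \<Phi>)"
      have fcol: "f \<in> verts \<Phi> \<rightarrow>\<^sub>E colors k"
        using g \<theta>(1) by (auto simp: f_def PiE_iff intro!: act_closed) (auto simp: colors_def)
      have "improper f e" if e: "e \<in> S" for e
      proof -
        have th: "tail \<Phi> e \<in> verts \<Phi>" "head \<Phi> e \<in> verts \<Phi>" using e S tail_in_verts head_in_verts by auto
        then have "(tail \<Phi> e, head \<Phi> e) \<in> conn S" using e by (auto simp: conn_def adjacent_def)
        then have cle: "cl (tail \<Phi> e) = cl (head \<Phi> e)"
          unfolding cl_def by (rule equiv_class_eq[OF equiv_conn])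
        let ?B = "cl (head \<Phi> e)"
        have inB: "tail \<Phi> e \<in> ?B" "head \<Phi> e \<in> ?B" using cl(2) th cle by auto
        show ?thesis
        proof (cases "?B \<in> Bal")
          case True
          then have nh: "\<not> half \<Phi> e" using e inB by (auto simp: Bal_def balanced_def)
          have "gain \<Phi> (e, True) \<in> carrier G" using nh e S by (auto intro: gain_closed)
          moreover have "g ?B \<in> colors k" using g True by auto
          ultimately show ?thesis
            using nh True \<theta>(1)[OF True] \<theta>(2)[OF True e inB] th cle
            by (simp add: improper_def f_def act_act m_assoc)
        next
          case False
          then show ?thesis using th cle by (simp add: improper_def f_def)
        qed
      qed
      then have "f \<in> improper_colorings k S" using fcol by (simp add: improper_colorings_def)
      moreover have "?F f = g"
      proof
        fix B
        show "?F f B = g B"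
        proof (cases "B \<in> Bal")
          case True
          then have B: "B \<in> components \<Phi> S" by (simp add: Bal_def)
          have "cl (r B) = B" "r B \<in> verts \<Phi>" using cl_eq[OF B r[OF B]] r[OF B] sub[OF B] by auto
          moreover have "g B \<in> colors k" using g True by auto
          ultimately show ?thesis using True \<theta>(1)[OF True] by (simp add: f_def act_one)
        next
          case False
          then show ?thesis using g by (auto simp: PiE_iff extensional_def)
        qed
      qed
      ultimately show "g \<in> ?F ` improper_colorings k S" by blast
    qed
  qed
  ultimately have "card (improper_colorings k S) = card (Bal \<rightarrow>\<^sub>E colors k)"
    by (metis card_image)
  then show ?thesis using finB by (simp add: card_PiE balanced_count_def Bal_def)
qed

section \<open>Inclusion-exclusion for proper colorings\<close>

lemma card_colors: "finite (carrier G) \<Longrightarrow> card (colors k) = 1 + Coset.order G * k"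
  by (simp add: colors_def card_image order_def card_cartesian_product)

text \<open>The evaluation point is the number of colors, so each power of it counts improper
  colorings. After the sums are exchanged, a coloring contributes the alternating sum over the
  subsets of its set of improper edges, which vanishes unless that set is empty.\<close>

lemma poly_gain_chromatic_poly:
  assumes fin: "finite (carrier G)"
  shows "poly (gain_chromatic_poly G \<Phi>) (1 + int (Coset.order G) * int k) =
    int (card {f \<in> verts \<Phi> \<rightarrow>\<^sub>E colors k. \<forall>e\<in>edges \<Phi>. \<not> improper f e})"
proof -
  let ?A = "verts \<Phi> \<rightarrow>\<^sub>E colors k"
  have finA: "finite ?A" using fin finite_verts by (intro finite_PiE) (auto simp: colors_def)
  have finP: "finite (Pow (edges \<Phi>))" using finite_edges by simp
  have "poly (gain_chromatic_poly G \<Phi>) (1 + int (Coset.order G) * int k)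
      = (\<Sum>S\<in>Pow (edges \<Phi>). (- 1) ^ card S * int (card (improper_colorings k S)))"
    unfolding gain_chromatic_poly_def poly_sum
    by (rule sum.cong) (simp_all add: poly_monom card_improper_colorings card_colors[OF fin])
  also have "\<dots> = (\<Sum>S\<in>Pow (edges \<Phi>). \<Sum>f\<in>?A. if \<forall>e\<in>S. improper f e then (- 1) ^ card S else 0)"
  proof (rule sum.cong)
    fix S
    have "(\<Sum>f\<in>?A. if \<forall>e\<in>S. improper f e then (- 1) ^ card S else (0::int))
        = (\<Sum>f\<in>improper_colorings k S. (- 1) ^ card S)"
      unfolding improper_colorings_def by (rule sum.inter_filter[symmetric, OF finA])
    then show "(- 1) ^ card S * int (card (improper_colorings k S)) =
        (\<Sum>f\<in>?A. if \<forall>e\<in>S. improper f e then (- 1) ^ card S else 0)" by simp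
  qed simp
  also have "\<dots> = (\<Sum>f\<in>?A. \<Sum>S\<in>Pow (edges \<Phi>). if \<forall>e\<in>S. improper f e then (- 1) ^ card S else 0)"
    by (rule sum.swap)
  also have "\<dots> = (\<Sum>f\<in>?A. if \<forall>e\<in>edges \<Phi>. \<not> improper f e then 1 else 0)"
  proof (rule sum.cong)
    fix f
    let ?I = "{e \<in> edges \<Phi>. improper f e}"
    have "(\<Sum>S\<in>Pow (edges \<Phi>). if \<forall>e\<in>S. improper f e then (- 1) ^ card S else (0::int))
        = (\<Sum>S\<in>{S \<in> Pow (edges \<Phi>). \<forall>e\<in>S. improper f e}. (- 1) ^ card S)"
      by (rule sum.inter_filter[symmetric, OF finP])
    also have "{S \<in> Pow (edges \<Phi>). \<forall>e\<in>S. improper f e} = Pow ?I" by auto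
    \<comment> \<open>Expanding the product chooses a summand for each edge, that is, a subset of
      \<open>?I\<close>.\<close>
    also have "(\<Sum>S\<in>Pow ?I. (- 1) ^ card S) = (\<Prod>e\<in>?I. (- 1 :: int) + 1)"
      using finite_edges by (subst prod_add) auto
    also have "\<dots> = (if \<forall>e\<in>edges \<Phi>. \<not> improper f e then 1 else 0)"
      using finite_edges by (auto simp: card_eq_0_iff power_0_left)
    finally show "(\<Sum>S\<in>Pow (edges \<Phi>). if \<forall>e\<in>S. improper f e then (- 1) ^ card S else 0)
        = (if \<forall>e\<in>edges \<Phi>. \<not> improper f e then 1 else (0::int))" .
  qed simp
  also have "\<dots> = int (card {f \<in> ?A. \<forall>e\<in>edges \<Phi>. \<not> improper f e})"
    using sum.inter_filter[OF finA, of "\<lambda>_. 1::int", symmetric] by simp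
  finally show ?thesis .
qed

end

section \<open>The full expansion\<close>

text \<open>The map \<open>?F\<close> is a bijection from pairs of an arbitrary group labeling and a
  proper coloring of the graph to the proper colorings of the expansion; the labelings account for
  the factor \<gamma>^n.\<close>

lemma poly_gain_chromatic_poly_full_expansion:
  assumes sg: "simple_graph V E" and ori: "orients ori E" and G: "group G"
    and fin: "finite (carrier G)"
  shows "poly (gain_chromatic_poly G (full_expansion G V E ori)) (1 + int (Coset.order G) * int k)
    = int (Coset.order G) ^ card V * poly (graph_chromatic_poly V E) (int k)"
proof -
  let ?\<Phi> = "full_expansion G V E ori"
  have finV: "finite V" using sg by (simp add: simple_graph_def)
  interpret group G by (rule G)
  interpret finite_gain_graph G ?\<Phi>
  proof
    show "is_gain_graph G ?\<Phi>" using is_gain_graph_expansion[OF G sg ori] by simp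
    show "finite (edges ?\<Phi>)"
      using fin finV simple_graph_finite_edges[OF sg] by (simp add: expansion_def)
  qed
  let ?P = "{f \<in> verts ?\<Phi> \<rightarrow>\<^sub>E colors k. \<forall>e\<in>edges ?\<Phi>. \<not> improper f e}"
  let ?Q = "(V \<rightarrow>\<^sub>E carrier G) \<times> proper_colorings V E k"
  let ?F = "\<lambda>(h, c). restrict (\<lambda>v. Some (h v, c v)) V"
  have vE: "verts ?\<Phi> = V" by (simp add: expansion_def)
  have edges_eq: "edges ?\<Phi> = Inl ` (carrier G \<times> E) \<union> Inr ` V" by (simp add: expansion_def)
  have half_iff: "improper f (Inr v) \<longleftrightarrow> f v = None" for f v
    unfolding improper_def by (simp add: expansion_def)
  have ordinary_iff: "improper f (Inl (g, e)) \<longleftrightarrow> f (snd (ori e)) = act (f (fst (ori e))) g" for f g e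
    unfolding improper_def by (simp add: expansion_def)
  have edge: "\<exists>u v. e = {u, v} \<and> u \<in> V \<and> v \<in> V \<and> ori e = (u, v)" if "e \<in> E" for e
    using sg ori that unfolding simple_graph_def orients_def
    by (metis insert_subset prod.collapse)
  have edge_iff: "(\<forall>g\<in>carrier G. \<not> improper f (Inl (g, e))) \<longleftrightarrow> c (fst (ori e)) \<noteq> c (snd (ori e))"
    if e: "e \<in> E" and f: "\<And>v. v \<in> V \<Longrightarrow> f v = Some (h v, c v)" and h: "h \<in> V \<rightarrow>\<^sub>E carrier G"
    for f h e and c :: "'a \<Rightarrow> nat"
  proof -
    obtain u v where uv: "u \<in> V" "v \<in> V" "ori e = (u, v)" using edge[OF e] by blast
    have hc: "h u \<in> carrier G" "h v \<in> carrier G" using h uv by auto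
    \<comment> \<open>This element is the gain of the one copy of \<open>e\<close> that is improper
      when \<open>c u = c v\<close>; every copy is proper when these differ.\<close>
    have "inv\<^bsub>G\<^esub> (h u) \<otimes>\<^bsub>G\<^esub> h v \<in> carrier G"
      "h v = h u \<otimes>\<^bsub>G\<^esub> (inv\<^bsub>G\<^esub> (h u) \<otimes>\<^bsub>G\<^esub> h v)"
      using hc by (simp_all add: m_assoc[symmetric])
    then show ?thesis using uv f[OF uv(1)] f[OF uv(2)] by (auto simp: ordinary_iff act_def)
  qed
  have proper_iff: "(\<forall>u\<in>V. \<forall>v\<in>V. {u, v} \<in> E \<longrightarrow> c u \<noteq> c v) \<longleftrightarrow>
      (\<forall>e\<in>E. c (fst (ori e)) \<noteq> c (snd (ori e)))" for c :: "'a \<Rightarrow> nat"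
  proof
    assume *: "\<forall>u\<in>V. \<forall>v\<in>V. {u, v} \<in> E \<longrightarrow> c u \<noteq> c v"
    show "\<forall>e\<in>E. c (fst (ori e)) \<noteq> c (snd (ori e))"
    proof
      fix e assume "e \<in> E"
      then show "c (fst (ori e)) \<noteq> c (snd (ori e))" using * edge[of e] by fastforce
    qed
  next
    assume *: "\<forall>e\<in>E. c (fst (ori e)) \<noteq> c (snd (ori e))"
    show "\<forall>u\<in>V. \<forall>v\<in>V. {u, v} \<in> E \<longrightarrow> c u \<noteq> c v"
    proof (intro ballI impI)
      fix u v assume uv: "{u, v} \<in> E"
      obtain x y where "{u, v} = {x, y}" "ori {u, v} = (x, y)" using edge[OF uv] by blast
      then show "c u \<noteq> c v" using *[rule_format, OF uv] by (auto simp: doubleton_eq_iff)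
    qed
  qed
  \<comment> \<open>Stated for any \<open>f\<close> with coordinates \<open>h\<close> and
    \<open>c\<close>, so that it serves both inclusions of the image equation.\<close>
  have in_P: "f \<in> ?P \<longleftrightarrow> (\<forall>e\<in>E. c (fst (ori e)) \<noteq> c (snd (ori e)))"
    if f: "\<And>v. v \<in> V \<Longrightarrow> f v = Some (h v, c v)" "f \<in> extensional V" and h: "h \<in> V \<rightarrow>\<^sub>E carrier G"
      and c: "c \<in> V \<rightarrow>\<^sub>E {..<k}" for f h c
  proof -
    have "f \<in> V \<rightarrow>\<^sub>E colors k" using f h c by (auto simp: PiE_iff colors_def)
    moreover have "(\<forall>e\<in>edges ?\<Phi>. \<not> improper f e) \<longleftrightarrow> (\<forall>e\<in>E. \<forall>g\<in>carrier G. \<not> improper f (Inl (g, e)))"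
      using f(1) by (auto simp: edges_eq half_iff)
    ultimately show ?thesis using edge_iff[OF _ f(1) h] by (simp add: vE)
  qed
  have inj: "inj_on ?F ?Q"
  proof (rule inj_onI, clarify)
    fix h c h' c'
    assume h: "h \<in> V \<rightarrow>\<^sub>E carrier G" "h' \<in> V \<rightarrow>\<^sub>E carrier G"
      and c: "c \<in> proper_colorings V E k" "c' \<in> proper_colorings V E k"
      and eq: "restrict (\<lambda>v. Some (h v, c v)) V = restrict (\<lambda>v. Some (h' v, c' v)) V"
    have "h v = h' v \<and> c v = c' v" if "v \<in> V" for v using fun_cong[OF eq, of v] that by simp
    then show "h = h' \<and> c = c'"
      using h c PiE_ext[of h V "\<lambda>_. carrier G" h'] PiE_ext[of c V "\<lambda>_. {..<k}" c']
      by (simp add: proper_colorings_def)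
  qed
  have image: "?F ` ?Q = ?P"
  proof
    show "?F ` ?Q \<subseteq> ?P"
    proof clarify
      fix h c assume h: "h \<in> V \<rightarrow>\<^sub>E carrier G" and c: "c \<in> proper_colorings V E k"
      show "restrict (\<lambda>v. Some (h v, c v)) V \<in> verts ?\<Phi> \<rightarrow>\<^sub>E colors k \<and>
          (\<forall>e\<in>edges ?\<Phi>. \<not> improper (restrict (\<lambda>v. Some (h v, c v)) V) e)"
        using in_P[of "restrict (\<lambda>v. Some (h v, c v)) V" h c] h c proper_iff[of c]
        by (simp add: proper_colorings_def)
    qed
    show "?P \<subseteq> ?F ` ?Q"
    proof
      fix f assume f: "f \<in> ?P"
      define h c where "h = restrict (\<lambda>v. fst (the (f v))) V" and "c = restrict (\<lambda>v. snd (the (f v))) V"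
      have col: "f v \<in> Some ` (carrier G \<times> {..<k})" if v: "v \<in> V" for v
      proof -
        have "Inr v \<in> edges ?\<Phi>" using v by (simp add: edges_eq)
        then have "\<not> improper f (Inr v)" using f by blast
        moreover have "f v \<in> colors k" using f v by (auto simp: vE)
        ultimately show ?thesis by (auto simp: half_iff colors_def)
      qed
      have fv: "f v = Some (h v, c v)" if "v \<in> V" for v using col[OF that] that by (auto simp: h_def c_def)
      have h: "h \<in> V \<rightarrow>\<^sub>E carrier G" and c: "c \<in> V \<rightarrow>\<^sub>E {..<k}" using col by (fastforce simp: h_def c_def)+
      have ext: "f \<in> extensional V" using f by (auto simp: vE PiE_iff)
      have "c \<in> proper_colorings V E k"
        using in_P[OF fv ext h c] f c proper_iff[of c] by (simp add: proper_colorings_def)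
      moreover have "f = ?F (h, c)" using fv ext by (auto simp: extensional_def restrict_def)
      ultimately show "f \<in> ?F ` ?Q" using h by blast
    qed
  qed
  have "card ?P = card ?Q" using card_image[OF inj] unfolding image .
  also have "\<dots> = Coset.order G ^ card V * card (proper_colorings V E k)"
    using finV by (simp add: card_cartesian_product card_PiE order_def)
  finally show ?thesis
    using poly_gain_chromatic_poly[OF fin, of k] poly_graph_chromatic_poly[OF sg, of k] by simp
qed

lemma poly_signless_poly: "poly (signless_poly n p) x = (- 1) ^ n * poly p (- x)"
  by (simp add: signless_poly_def poly_pcompose)

text \<open>At \<lambda> = -(1 + \<gamma>k) one has 1 + \<lambda> = -\<gamma>k, and the coloring
  identity turns into the claimed equality of values. Since \<gamma> > 0, these points are
  infinitely many, so the polynomials coincide.\<close>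

lemma signless_full_expansion:
  assumes sg: "simple_graph V E" and ori: "orients ori E" and G: "group G"
    and fin: "finite (carrier G)" and pos: "Coset.order G > 0"
  shows "signless_poly (card V) (gain_chromatic_poly G (full_expansion G V E ori)) =
    (\<Sum>j\<le>card V. smult (graph_whitney V E j * int (Coset.order G) ^ j) ([:1, 1:] ^ (card V - j)))"
    (is "?L = ?R")
proof (rule ccontr)
  assume "?L \<noteq> ?R"
  let ?n = "card V" and ?\<gamma> = "int (Coset.order G)"
  have "poly ?L (- (1 + ?\<gamma> * int k)) = poly ?R (- (1 + ?\<gamma> * int k))" for k
  proof -
    have "poly ?L (- (1 + ?\<gamma> * int k)) = ?\<gamma> ^ ?n * ((- 1) ^ ?n * poly (graph_chromatic_poly V E) (int k))"
      using poly_gain_chromatic_poly_full_expansion[OF sg ori G fin, of k]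
      by (simp add: poly_signless_poly add.commute)
    also have "(- 1) ^ ?n * poly (graph_chromatic_poly V E) (int k)
        = poly (signless_poly ?n (graph_chromatic_poly V E)) (- int k)"
      by (simp add: poly_signless_poly)
    also have "\<dots> = (\<Sum>j\<le>?n. graph_whitney V E j * (- int k) ^ (?n - j))"
      by (simp add: signless_graph_chromatic_poly[OF sg] poly_sum poly_monom)
    also have "?\<gamma> ^ ?n * \<dots> = (\<Sum>j\<le>?n. graph_whitney V E j * ?\<gamma> ^ j * (- (?\<gamma> * int k)) ^ (?n - j))"
      unfolding sum_distrib_left
    proof (rule sum.cong)
      fix j assume "j \<in> {..?n}"
      then have "?\<gamma> ^ ?n = ?\<gamma> ^ j * ?\<gamma> ^ (?n - j)" by (simp flip: power_add)
      moreover have "(- (?\<gamma> * int k)) ^ (?n - j) = ?\<gamma> ^ (?n - j) * (- int k) ^ (?n - j)"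
        by (simp flip: power_mult_distrib)
      ultimately show "?\<gamma> ^ ?n * (graph_whitney V E j * (- int k) ^ (?n - j)) =
          graph_whitney V E j * ?\<gamma> ^ j * (- (?\<gamma> * int k)) ^ (?n - j)" by simp
    qed simp
    also have "\<dots> = poly ?R (- (1 + ?\<gamma> * int k))" by (simp add: poly_sum)
    finally show ?thesis .
  qed
  then have "range (\<lambda>k. - (1 + ?\<gamma> * int k)) \<subseteq> {x. poly (?L - ?R) x = 0}" by auto
  moreover have "finite {x. poly (?L - ?R) x = 0}" using \<open>?L \<noteq> ?R\<close> by (intro poly_roots_finite) simp
  ultimately have "finite (range (\<lambda>k. - (1 + ?\<gamma> * int k)))" by (rule finite_subset)
  moreover have "inj (\<lambda>k. - (1 + ?\<gamma> * int k))" using pos by (auto intro: injI)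
  ultimately show False using finite_imageD by blast
qed

lemma coeff_one_plus_X_power: "coeff ([:1, 1:] ^ n :: int poly) m = int (n choose m)"
proof (cases "m \<le> n")
  case True
  then show ?thesis by (simp add: coeff_linear_poly_power)
next
  case False
  then show ?thesis by (simp add: coeff_eq_0 degree_linear_power)
qed

lemma gain_whitney_full_expansion:
  assumes "simple_graph V E" "orients ori E" "group G" "finite (carrier G)" "Coset.order G > 0"
    and i: "i \<le> card V"
  shows "gain_whitney G (full_expansion G V E ori) i =
    (\<Sum>j = 0..i. graph_whitney V E j * int ((card V - j) choose (i - j)) * int (Coset.order G) ^ j)"
proof -
  let ?n = "card V" and ?\<gamma> = "int (Coset.order G)"
  have v: "verts (full_expansion G V E ori) = V" by (simp add: expansion_def)
  have "gain_whitney G (full_expansion G V E ori) i =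
      (\<Sum>j\<le>?n. graph_whitney V E j * ?\<gamma> ^ j * int ((?n - j) choose (?n - i)))"
    unfolding gain_whitney_def v signless_full_expansion[OF assms(1-5)]
    by (simp add: coeff_sum coeff_one_plus_X_power)
  \<comment> \<open>For \<open>i < j\<close> the upper index \<open>?n - j\<close> is smaller than
    \<open>?n - i\<close>, and the binomial vanishes.\<close>
  also have "\<dots> = (\<Sum>j = 0..i. graph_whitney V E j * ?\<gamma> ^ j * int ((?n - j) choose (?n - i)))"
    using i by (intro sum.mono_neutral_right) (auto intro: binomial_eq_0)
  also have "\<dots> = (\<Sum>j = 0..i. graph_whitney V E j * int ((?n - j) choose (i - j)) * ?\<gamma> ^ j)"
  proof (rule sum.cong)
    fix j assume "j \<in> {0..i}"
    then have "(?n - j) choose (?n - i) = (?n - j) choose (i - j)"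
      using i by (subst binomial_symmetric) auto
    then show "graph_whitney V E j * ?\<gamma> ^ j * int ((?n - j) choose (?n - i)) =
        graph_whitney V E j * int ((?n - j) choose (i - j)) * ?\<gamma> ^ j" by simp
  qed simp
  finally show ?thesis .
qed

section \<open>Signs of the Whitney numbers of a graph\<close>

lemma proper_colorings_delete_edge:
  assumes sg: "simple_graph V E" and e: "{u, v} \<in> E"
  shows "proper_colorings V (E - {{u, v}}) k =
    proper_colorings V E k \<union> {f \<in> proper_colorings V (E - {{u, v}}) k. f u = f v}"
    and "proper_colorings V E k \<inter> {f \<in> proper_colorings V (E - {{u, v}}) k. f u = f v} = {}"
proof -
  have uV: "u \<in> V" "v \<in> V" using sg e by (auto simp: simple_graph_def)
  have "f \<in> proper_colorings V E k \<longleftrightarrow> f \<in> proper_colorings V (E - {{u, v}}) k \<and> f u \<noteq> f v" for f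
    using uV e unfolding proper_colorings_def by (auto simp: doubleton_eq_iff) metis+
  then show "proper_colorings V (E - {{u, v}}) k =
    proper_colorings V E k \<union> {f \<in> proper_colorings V (E - {{u, v}}) k. f u = f v}"
    and "proper_colorings V E k \<inter> {f \<in> proper_colorings V (E - {{u, v}}) k. f u = f v} = {}" by auto
qed

text \<open>Only \<open>{u, v}\<close> itself would collapse to a point under \<open>m\<close>.
  Edges that become parallel merge, because edges are sets and the image is a set.\<close>

lemma simple_graph_contract:
  assumes sg: "simple_graph V E" and e: "{u, v} \<in> E" and uv: "u \<noteq> v"
  defines "m \<equiv> \<lambda>x. if x = v then u else x"
  shows "simple_graph (V - {v}) ((`) m ` (E - {{u, v}}))"
proof -
  have uV: "u \<in> V" "v \<in> V" using sg e by (auto simp: simple_graph_def)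
  have "m ` d \<subseteq> V - {v} \<and> card (m ` d) = 2" if d: "d \<in> E - {{u, v}}" for d
  proof -
    have dd: "d \<subseteq> V" "card d = 2" using sg d by (auto simp: simple_graph_def)
    then obtain a b where ab: "d = {a, b}" "a \<noteq> b" by (auto simp: card_2_iff)
    then have "m a \<noteq> m b" using d by (auto simp: m_def)
    then have "card (m ` d) = 2" by (simp add: ab(1))
    moreover have "m x \<in> V - {v}" if "x \<in> V" for x using that uV uv by (simp add: m_def)
    ultimately show ?thesis using dd(1) by blast
  qed
  then show ?thesis using sg by (auto simp: simple_graph_def)
qed

text \<open>The proper colorings after deletion either separate \<open>u\<close> and
  \<open>v\<close>, and are proper for \<open>E\<close>, or identify them, and are colorings of the
  contraction.\<close>

lemma graph_chromatic_poly_delete_contract: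
  assumes sg: "simple_graph V E" and e: "{u, v} \<in> E" and uv: "u \<noteq> v"
  defines "m \<equiv> \<lambda>x. if x = v then u else x"
  shows "graph_chromatic_poly V E =
    graph_chromatic_poly V (E - {{u, v}}) - graph_chromatic_poly (V - {v}) ((`) m ` (E - {{u, v}}))"
proof (rule int_poly_eqI_nat)
  fix k
  have finV: "finite V" and sg': "simple_graph V (E - {{u, v}})" using sg by (auto simp: simple_graph_def)
  let ?A = "{f \<in> proper_colorings V (E - {{u, v}}) k. f u = f v}"
  have "card (proper_colorings V (E - {{u, v}}) k) = card (proper_colorings V E k) + card ?A"
    using proper_colorings_delete_edge[OF sg e, of k] finite_proper_colorings[OF finV]
      card_Un_disjoint[of "proper_colorings V E k" ?A] by simp
  also have "card ?A = card (proper_colorings (V - {v}) ((`) m ` (E - {{u, v}})) k)"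
    unfolding m_def by (rule card_proper_colorings_contract[OF sg e uv])
  finally show "poly (graph_chromatic_poly V E) (int k) =
    poly (graph_chromatic_poly V (E - {{u, v}}) -
      graph_chromatic_poly (V - {v}) ((`) m ` (E - {{u, v}}))) (int k)"
    using simple_graph_contract[OF sg e uv]
    by (simp add: poly_graph_chromatic_poly sg sg' m_def)
qed

section \<open>Components under deletion and contraction\<close>

definition reachable :: "'v set set \<Rightarrow> ('v \<times> 'v) set" where
  "reachable E = {(u, v). {u, v} \<in> E}\<^sup>*"

definition component_rel :: "'v set \<Rightarrow> 'v set set \<Rightarrow> ('v \<times> 'v) set" where
  "component_rel V E = {(u, v). u \<in> V \<and> v \<in> V \<and> (u, v) \<in> reachable E}"

lemma sym_reachable: "(u, v) \<in> reachable E \<Longrightarrow> (v, u) \<in> reachable E"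
proof -
  have "sym {(u, v). {u, v} \<in> E}" by (auto simp: sym_def insert_commute)
  from sym_rtrancl[OF this] show "(u, v) \<in> reachable E \<Longrightarrow> (v, u) \<in> reachable E"
    unfolding reachable_def by (rule symD)
qed

lemma graph_components_eq: "graph_components V E = V // component_rel V E"
proof -
  have "{(u, v). {u, v} \<in> E} \<union> {(u, v). {u, v} \<in> E}\<inverse> = {(u, v). {u, v} \<in> E}"
    by (auto simp: insert_commute)
  then show ?thesis
    by (simp add: graph_components_def conn_classes_def component_rel_def reachable_def)
qed

lemma equiv_component_rel: "equiv V (component_rel V E)"
proof (rule equivI)
  show "component_rel V E \<subseteq> V \<times> V" by (auto simp: component_rel_def)
  show "refl_on V (component_rel V E)" by (auto simp: component_rel_def refl_on_def reachable_def)
  show "sym (component_rel V E)" by (auto simp: component_rel_def sym_def intro: sym_reachable)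
  show "trans (component_rel V E)"
    unfolding component_rel_def trans_def reachable_def by (auto intro: rtrancl_trans)
qed

lemma card_graph_components_le:
  assumes "finite V"
  shows "card (graph_components V E) \<le> card V"
proof -
  have "V // component_rel V E = (\<lambda>x. component_rel V E `` {x}) ` V" by (auto simp: quotient_def)
  then show ?thesis using assms by (simp add: graph_components_eq card_image_le)
qed

lemma card_graph_components_empty: "card (graph_components V {}) = card V"
proof -
  have "V // component_rel V {} = (\<lambda>x. {x}) ` V"
    by (auto simp: quotient_def component_rel_def reachable_def)
  then show ?thesis by (simp add: graph_components_eq card_image)
qed

lemma card_graph_components_mono:
  assumes "finite V" "D \<subseteq> E"
  shows "card (graph_components V E) \<le> card (graph_components V D)"
proof -
  have "reachable D \<subseteq> reachable E"
    unfolding reachable_def using assms(2) by (intro rtrancl_mono) auto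
  then have "component_rel V D \<subseteq> component_rel V E" by (auto simp: component_rel_def)
  then show ?thesis unfolding graph_components_eq
    using assms(1)
    by (intro finite_refines_card_le finite_quotient equiv_type equiv_component_rel)
qed

text \<open>Taking images under \<open>m\<close> is a bijection between the classes even when
  \<open>m\<close> merges equivalent points, as contraction does.\<close>

lemma card_quotient_eq:
  assumes r: "equiv A r" and s: "equiv B s" and m: "m ` A = B"
    and iff: "\<And>x y. x \<in> A \<Longrightarrow> y \<in> A \<Longrightarrow> (x, y) \<in> r \<longleftrightarrow> (m x, m y) \<in> s"
  shows "card (A // r) = card (B // s)"
proof -
  have cl: "m ` (r `` {x}) = s `` {m x}" if x: "x \<in> A" for x
  proof
    show "m ` (r `` {x}) \<subseteq> s `` {m x}"
    proof (rule image_subsetI)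
      fix y assume "y \<in> r `` {x}"
      moreover have "y \<in> A" using calculation equiv_type[OF r] by auto
      ultimately show "m y \<in> s `` {m x}" using iff[OF x] by simp
    qed
    show "s `` {m x} \<subseteq> m ` (r `` {x})"
    proof
      fix z assume z: "z \<in> s `` {m x}"
      then have "z \<in> B" using equiv_type[OF s] by auto
      then obtain y where "y \<in> A" "z = m y" using m by auto
      then show "z \<in> m ` (r `` {x})" using z iff x by auto
    qed
  qed
  have "bij_betw ((`) m) (A // r) (B // s)"
  proof (rule bij_betw_imageI)
    show "inj_on ((`) m) (A // r)"
    proof (rule inj_onI)
      fix X Y assume "X \<in> A // r" "Y \<in> A // r" and eq: "m ` X = m ` Y"
      then obtain x y where xy: "x \<in> A" "y \<in> A" "X = r `` {x}" "Y = r `` {y}"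
        by (auto simp: quotient_def)
      then have "s `` {m x} = s `` {m y}" using eq cl by simp
      then have "(m x, m y) \<in> s" using eq_equiv_class[OF _ s] xy m by blast
      then have "(x, y) \<in> r" using iff[OF xy(1,2)] by simp
      then show "X = Y" using xy equiv_class_eq[OF r] by simp
    qed
    have "A // r = (\<lambda>x. r `` {x}) ` A" "B // s = (\<lambda>y. s `` {y}) ` B" by (auto simp: quotient_def)
    then show "(`) m ` (A // r) = B // s" using cl by (simp add: image_image flip: m)
  qed
  then show ?thesis by (rule bij_betw_same_card)
qed

text \<open>The map \<open>m\<close> moves a vertex only within its component, so it preserves and
  reflects reachability.\<close>

lemma card_graph_components_contract:
  assumes sg: "simple_graph V E" and e: "{u, v} \<in> E" and uv: "u \<noteq> v"
  defines "m \<equiv> \<lambda>x. if x = v then u else x"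
  shows "card (graph_components (V - {v}) ((`) m ` (E - {{u, v}}))) = card (graph_components V E)"
proof -
  let ?E = "(`) m ` (E - {{u, v}})"
  have uV: "u \<in> V" "v \<in> V" using sg e by (auto simp: simple_graph_def)
  have mx: "(x, m x) \<in> reachable E" for x
    using e by (auto simp: m_def reachable_def insert_commute)
  have fwd: "(m x, m y) \<in> reachable ?E" if "(x, y) \<in> reachable E" for x y
    using that unfolding reachable_def
  proof (induction rule: rtrancl_induct)
    case (step y z)
    show ?case
    proof (cases "{y, z} = {u, v}")
      case True
      then have "m y = m z" by (auto simp: m_def doubleton_eq_iff)
      then show ?thesis using step.IH by simp
    next
      case False
      then have "m ` {y, z} \<in> ?E" using step.hyps(2) by blast
      then show ?thesis using step.IH by (auto intro: rtrancl.rtrancl_into_rtrancl)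
    qed
  qed simp
  have edge: "(x, y) \<in> reachable E" if xy: "{x, y} \<in> ?E" for x y
  proof -
    obtain d where d: "d \<in> E" "{x, y} = m ` d" using xy by blast
    obtain a b where ab: "d = {a, b}" using sg d(1) by (auto simp: simple_graph_def card_2_iff)
    have "(a, b) \<in> reachable E" using d(1) ab by (auto simp: reachable_def)
    then have "(m a, m b) \<in> reachable E"
      using mx[of a] mx[of b] sym_reachable[of a "m a"] unfolding reachable_def
      by (meson rtrancl_trans)
    moreover have "{x, y} = {m a, m b}" using d(2) ab by simp
    ultimately show ?thesis using sym_reachable by (auto simp: doubleton_eq_iff)
  qed
  have bwd: "(x, y) \<in> reachable E" if "(x, y) \<in> reachable ?E" for x y
    using that unfolding reachable_def[of ?E]
  proof (induction rule: rtrancl_induct)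
    case base
    show ?case by (simp add: reachable_def)
  next
    case (step y z)
    then show ?case using edge[of y z]
      unfolding reachable_def by auto
  qed
  have iff: "(x, y) \<in> reachable E \<longleftrightarrow> (m x, m y) \<in> reachable ?E" for x y
  proof
    assume "(m x, m y) \<in> reachable ?E"
    then have "(m x, m y) \<in> reachable E" by (rule bwd)
    then show "(x, y) \<in> reachable E"
      using mx[of x] sym_reachable[OF mx[of y]] unfolding reachable_def by (meson rtrancl_trans)
  qed (rule fwd)
  have "card (V // component_rel V E) = card ((V - {v}) // component_rel (V - {v}) ?E)"
  proof (rule card_quotient_eq[OF equiv_component_rel equiv_component_rel])
    show im: "m ` V = V - {v}" using uV uv by (auto simp: m_def image_iff)
    show "(x, y) \<in> component_rel V E \<longleftrightarrow> (m x, m y) \<in> component_rel (V - {v}) ?E"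
      if "x \<in> V" "y \<in> V" for x y
      using that im iff[of x y] by (auto simp: component_rel_def)
  qed
  then show ?thesis by (simp add: graph_components_eq)
qed

section \<open>The sign induction\<close>

lemma graph_chromatic_poly_empty:
  assumes "finite V"
  shows "graph_chromatic_poly V {} = monom 1 (card V)"
proof (rule int_poly_eqI_nat)
  fix k
  have "simple_graph V {}" using assms by (simp add: simple_graph_def)
  moreover have "card (proper_colorings V {} k) = k ^ card V"
    using assms by (simp add: proper_colorings_def card_PiE)
  ultimately show "poly (graph_chromatic_poly V {}) (int k) = poly (monom 1 (card V)) (int k)"
    by (simp add: poly_graph_chromatic_poly poly_monom)
qed

lemma coeff_signless_poly: "coeff (signless_poly n p) m = (- 1) ^ n * (- 1) ^ m * coeff p m"
  by (simp add: signless_poly_def coeff_pcompose_linear)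

text \<open>The contraction has one vertex less, so in signless form its minus sign becomes a plus
  and positivity is inherited. The claim is indexed by the exponent \<open>m\<close>, which is
  common to both smaller graphs although their orders differ.\<close>

lemma coeff_signless_graph_chromatic_poly:
  assumes "simple_graph V E"
  shows "(card (graph_components V E) \<le> m \<and> m \<le> card V \<longrightarrow>
      coeff (signless_poly (card V) (graph_chromatic_poly V E)) m > 0) \<and>
    (m < card (graph_components V E) \<longrightarrow>
      coeff (signless_poly (card V) (graph_chromatic_poly V E)) m = 0)"
  using assms
proof (induction "card E" arbitrary: V E rule: less_induct)
  case less
  note sg = less.prems
  have finV: "finite V" using sg by (simp add: simple_graph_def)
  show ?case
  proof (cases "E = {}")
    case True
    then show ?thesis
      using finV by (auto simp: card_graph_components_empty graph_chromatic_poly_empty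
          coeff_signless_poly simp flip: power_add)
  next
    case False
    then obtain u v where e: "{u, v} \<in> E" and uv: "u \<noteq> v"
      using sg by (metis all_not_in_conv card_2_iff simple_graph_def)
    define m' where "m' = (\<lambda>x. if x = v then u else x)"
    let ?D = "E - {{u, v}}" and ?C = "(`) m' ` (E - {{u, v}})" and ?n = "card V"
    have vV: "v \<in> V" using sg e by (auto simp: simple_graph_def)
    then have n: "?n = Suc (card (V - {v}))" using finV by (metis card_Suc_Diff1)
    have finE: "finite E" using simple_graph_finite_edges[OF sg] .
    have cD: "card ?D < card E" using e finE by (intro psubset_card_mono) auto
    have cC: "card ?C < card E" using cD card_image_le[of ?D "(`) m'"] finE by simp
    have sD: "simple_graph V ?D" using sg by (auto simp: simple_graph_def)
    have sC: "simple_graph (V - {v}) ?C" unfolding m'_def by (rule simple_graph_contract[OF sg e uv])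
    let ?a = "\<lambda>V E. coeff (signless_poly (card V) (graph_chromatic_poly V E)) m"
    let ?c = "card (graph_components V E)" and ?d = "card (graph_components V ?D)"
    have rec: "?a V E = ?a V ?D + ?a (V - {v}) ?C"
      by (simp add: coeff_signless_poly n m'_def algebra_simps
          graph_chromatic_poly_delete_contract[OF sg e uv])
    have comp: "card (graph_components (V - {v}) ?C) = ?c"
      unfolding m'_def by (rule card_graph_components_contract[OF sg e uv])
    have cd: "?c \<le> ?d" by (rule card_graph_components_mono[OF finV]) blast
    have dn: "?d \<le> ?n" by (rule card_graph_components_le[OF finV])
    have top: "?a (V - {v}) ?C = 0" if "m > card (V - {v})"
      using that degree_graph_chromatic_poly[OF sC] by (simp add: coeff_signless_poly coeff_eq_0)
    have D: "?d \<le> m \<and> m \<le> ?n \<longrightarrow> ?a V ?D > 0" "m < ?d \<longrightarrow> ?a V ?D = 0"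
      using less.hyps[OF cD sD] by blast+
    have C: "?c \<le> m \<and> m \<le> card (V - {v}) \<longrightarrow> ?a (V - {v}) ?C > 0" "m < ?c \<longrightarrow> ?a (V - {v}) ?C = 0"
      using less.hyps[OF cC sC] unfolding comp by blast+
    have "?a V E > 0" if m: "?c \<le> m" "m \<le> ?n"
    \<comment> \<open>The contraction has degree at most \<open>?n - 1\<close>, so the top
      coefficient comes from the deletion. Below the top the contraction, which has the same number
      of components as \<open>E\<close>, is positive; the deletion may have more components and is
      only known to be nonnegative.\<close>
    proof (cases "m = ?n")
      case True
      then show ?thesis using D(1) dn top n rec by simp
    next
      case False
      then have "?a (V - {v}) ?C > 0" using C(1) m n by simp
      moreover have "?a V ?D \<ge> 0" using D m(2) by (cases "m < ?d") auto
      ultimately show ?thesis using rec by linarith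
    qed
    moreover have "?a V E = 0" if "m < ?c"
      using that C(2) D(2) cd rec by simp
    ultimately show ?thesis by blast
  qed
qed

lemma graph_whitney_sign:
  assumes "simple_graph V E" "j \<le> card V"
  shows graph_whitney_pos: "j \<le> card V - card (graph_components V E) \<Longrightarrow> graph_whitney V E j > 0"
    and graph_whitney_zero: "j > card V - card (graph_components V E) \<Longrightarrow> graph_whitney V E j = 0"
proof -
  have "card (graph_components V E) \<le> card V"
    using assms(1) by (intro card_graph_components_le) (simp add: simple_graph_def)
  then show "j \<le> card V - card (graph_components V E) \<Longrightarrow> graph_whitney V E j > 0"
    and "j > card V - card (graph_components V E) \<Longrightarrow> graph_whitney V E j = 0"
    using coeff_signless_graph_chromatic_poly[OF assms(1), of "card V - j"] assms(2)
    by (auto simp: graph_whitney_def)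
qed

text \<open>The polynomial \<open>p\<close> is built from \<open>V\<close>, \<open>E\<close>,
  \<open>n\<close> and \<open>i\<close> alone, hence is the same for all finite groups; this is the
  sense in which the Whitney number is a polynomial function of \<gamma>.\<close>

theorem theorem1:
  fixes V :: "'v set" and E :: "'v set set" and G :: "('g, 'm) monoid_scheme"
    and ori :: "'v set \<Rightarrow> 'v \<times> 'v" and n c \<gamma> i :: nat
  assumes "simple_graph V E" and "card V = n" and "n > 0"
    and "card (graph_components V E) = c"
    and "orients ori E"
    and "group G" and "finite (carrier G)" and "Coset.order G = \<gamma>" and "\<gamma> > 0"
    and "i \<le> n"
  shows "gain_whitney G (full_expansion G V E ori) i =
           (\<Sum>j = 0..i. graph_whitney V E j * int ((n - j) choose (i - j)) * int \<gamma> ^ j)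
         \<and> (let p = (\<Sum>j = 0..i. monom (graph_whitney V E j * int ((n - j) choose (i - j))) j)
            in gain_whitney G (full_expansion G V E ori) i = poly p (int \<gamma>)
               \<and> degree p = min i (n - c)
               \<and> (\<forall>j \<le> degree p. coeff p j > 0))"
proof -
  define p where "p = (\<Sum>j = 0..i. monom (graph_whitney V E j * int ((n - j) choose (i - j))) j)"
  have w: "gain_whitney G (full_expansion G V E ori) i =
      (\<Sum>j = 0..i. graph_whitney V E j * int ((n - j) choose (i - j)) * int \<gamma> ^ j)"
    using gain_whitney_full_expansion[of V E ori G i] assms by simp
  have "poly p (int \<gamma>) = (\<Sum>j = 0..i. graph_whitney V E j * int ((n - j) choose (i - j)) * int \<gamma> ^ j)"
    by (simp add: p_def poly_sum poly_monom)
  moreover have cp: "coeff p j = (if j \<le> i then graph_whitney V E j * int ((n - j) choose (i - j)) else 0)" for j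
    by (auto simp: p_def coeff_sum)
  \<comment> \<open>The binomial coefficient is positive because \<open>j \<le> i \<le> n\<close>,
    so the sign is that of the Whitney number of the graph. At the largest such \<open>j\<close>
    this also bounds the degree from below.\<close>
  have pos: "coeff p j > 0" if "j \<le> min i (n - c)" for j
    using that graph_whitney_pos[OF assms(1), of j] assms by (simp add: cp)
  have zero: "coeff p j = 0" if "j > min i (n - c)" for j
    using that graph_whitney_zero[OF assms(1), of j] assms by (auto simp: cp)
  have "degree p = min i (n - c)"
    using pos[of "min i (n - c)"] zero by (intro antisym degree_le le_degree) auto
  ultimately show ?thesis using w pos by (simp add: Let_def flip: p_def)
qed

end
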